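(* Let $\ell_1\ge\dots\ge\ell_\mu$, $a=\sum_i\ell_i$, and let $$\left\{\begin{bmatrix}I_d&0\\ 0&N\end{bmatrix},\begin{bmatrix}\Omega&0\\ F_{21}&I_a\end{bmatrix}\right\}$$ be a sufficiently smooth pair of matrix functions in T-canonical form, i.e. $N\in SUT_{column}$. Then there exist $R\in BUT_{nonsingular}$ and a matrix function $\tilde F_{21}:\mathcal I\to\mathbb{R}^{a\times d}$ such that $$\left\{\begin{bmatrix}I_d&0\\ 0&N\end{bmatrix},\begin{bmatrix}\Omega&0\\ F_{21}&I_a\end{bmatrix}\right\}\sim\left\{\begin{bmatrix}I_d&0\\ 0&N^{(E_c)}\end{bmatrix},\begin{bmatrix}\Omega&0\\ \tilde F_{21}&R^{-1}\end{bmatrix}\right\},$$ and the latter pair is in PreSCF. Moreover, this pair is equivalent to $$\left\{\begin{bmatrix}I_d&0\\ 0&N^{(E_c)}\end{bmatrix},\begin{bmatrix}\Omega&0\\ 0&I_a\end{bmatrix}\right\}$$ with the same $\Omega$.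
   Context: $\mathcal I\subseteq\mathbb{R}$ is an interval; all matrix functions are real and defined on $\mathcal I$; $'$ is differentiation in $t$. Equivalence: pairs of $m\times m$ matrix functions satisfy $\{E,F\}\sim\{\bar E,\bar F\}$ if there are pointwise nonsingular, sufficiently smooth $L,K:\mathcal I\to\mathbb{R}^{m\times m}$ with $\bar E=LEK$, $\bar F=LFK+LEK'$. Block structures: $\mu\ge 2$, positive integers $\ell_1\ge\dots\ge\ell_\mu$ with sum $a$; $a\times a$ matrix functions are partitioned into blocks of size $\ell_i\times\ell_j$. $BUT$: block upper triangular matrix functions (blocks $(i,j)$ with $i>j$ vanish). $BUT_{nonsingular}$: pointwise nonsingular elements of $BUT$. $SUT$: strictly block upper triangular ones (blocks $(i,j)$ with $i\ge j$ vanish). $SUT_{column}$: those $N\in SUT$ with $\operatorname{rank}N_{i,i+1}(t)=\ell_{i+1}$ for all $t\in\mathcal I$, $i=1,\dots,\mu-1$. $N^{(E_c)}$ is the constant matrix with blocks $N^{(E_c)}_{i,i+1}=\begin{bmatrix}I_{\ell_{i+1}}\\ 0\end{bmatrix}$ and all other blocks zero. PreSCF: a pair $\left\{\begin{bmatrix} I_d&0\\ 0&N^{(E_c)}\end{bmatrix},\begin{bmatrix}F_{11}&F_{12}\\ F_{21}&F_{22}\end{bmatrix}\right\}$ is in PreSCF if $F_{22}\in BUT_{nonsingular}$ and $F_{21}F_{12}\in BUT$. *)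

theory Defs
  imports
    "HOL-Analysis.Analysis"
    "HOL-Library.Extended_Nat"
    "Jordan_Normal_Form.DL_Rank"
    "Jordan_Normal_Form.Gauss_Jordan_Elimination"
begin

text \<open>
  A matrix function on the interval \<open>I\<close> is a function \<open>real \<Rightarrow> real mat\<close> of which only the values
  on \<open>I\<close> matter. Derivatives are taken within \<open>I\<close>, hence one-sided at end points belonging to \<open>I\<close>.
\<close>

type_synonym mat_fun = "real \<Rightarrow> real mat"

definition mat_fun_on :: "real set \<Rightarrow> nat \<Rightarrow> nat \<Rightarrow> mat_fun \<Rightarrow> bool" where
  "mat_fun_on I nr nc A \<longleftrightarrow> (\<forall>t\<in>I. A t \<in> carrier_mat nr nc)"

definition Ck_on :: "enat \<Rightarrow> real set \<Rightarrow> (real \<Rightarrow> real) \<Rightarrow> bool" where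
  "Ck_on k I f \<longleftrightarrow>
     (\<exists>D :: nat \<Rightarrow> real \<Rightarrow> real.
        (\<forall>t\<in>I. D 0 t = f t) \<and>
        (\<forall>n. enat n < k \<longrightarrow> (\<forall>t\<in>I. (D n has_real_derivative D (Suc n) t) (at t within I))) \<and>
        (\<forall>n. enat n \<le> k \<longrightarrow> continuous_on I (D n)))"

definition Ck_mat_fun :: "enat \<Rightarrow> real set \<Rightarrow> nat \<Rightarrow> nat \<Rightarrow> mat_fun \<Rightarrow> bool" where
  "Ck_mat_fun k I nr nc A \<longleftrightarrow>
     mat_fun_on I nr nc A \<and> (\<forall>i<nr. \<forall>j<nc. Ck_on k I (\<lambda>t. A t $$ (i, j)))"

definition mat_fun_deriv :: "real set \<Rightarrow> nat \<Rightarrow> nat \<Rightarrow> mat_fun \<Rightarrow> mat_fun" where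
  "mat_fun_deriv I nr nc A =
     (\<lambda>t. mat nr nc (\<lambda>(i, j). vector_derivative (\<lambda>s. A s $$ (i, j)) (at t within I)))"

text \<open>
  The parameter \<open>k\<close> is the smoothness class demanded of the transformations \<open>L\<close> and \<open>K\<close>. It should be
  at least \<open>1\<close>: only then is \<open>mat_fun_deriv\<close> of \<open>K\<close> its derivative rather than an arbitrary value.
  Eliminations differentiate the data, so the pairs themselves need a larger, but for finite \<open>k\<close>
  still finite, class; this is the meaning given to ``sufficiently smooth''.
\<close>

definition pair_equiv ::
    "enat \<Rightarrow> real set \<Rightarrow> nat \<Rightarrow> mat_fun \<times> mat_fun \<Rightarrow> mat_fun \<times> mat_fun \<Rightarrow> bool" where
  "pair_equiv k I m P Q \<longleftrightarrow>
     (case (P, Q) of ((E, F), (E', F')) \<Rightarrow>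
        \<exists>L K. Ck_mat_fun k I m m L \<and> Ck_mat_fun k I m m K \<and>
          (\<forall>t\<in>I. invertible_mat (L t) \<and> invertible_mat (K t) \<and>
             E' t = L t * E t * K t \<and>
             F' t = L t * F t * K t + L t * E t * mat_fun_deriv I m m K t))"

text \<open>
  Block sizes are given by a list \<open>ls\<close>, so the blocks are indexed by \<open>0, \<dots>, length ls - 1\<close>.
\<close>

definition block_sizes :: "nat list \<Rightarrow> bool" where
  "block_sizes ls \<longleftrightarrow> length ls \<ge> 2 \<and> (\<forall>l\<in>set ls. l > 0) \<and> sorted_wrt (\<ge>) ls"

definition offset :: "nat list \<Rightarrow> nat \<Rightarrow> nat" where
  "offset ls i = sum_list (take i ls)"

definition block :: "nat list \<Rightarrow> nat \<Rightarrow> nat \<Rightarrow> real mat \<Rightarrow> real mat" where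
  "block ls i j A =
     mat (ls ! i) (ls ! j) (\<lambda>(r, c). A $$ (offset ls i + r, offset ls j + c))"

definition BUT :: "real set \<Rightarrow> nat list \<Rightarrow> mat_fun set" where
  "BUT I ls = {A. mat_fun_on I (sum_list ls) (sum_list ls) A \<and>
     (\<forall>t\<in>I. \<forall>i<length ls. \<forall>j<length ls. i > j \<longrightarrow> block ls i j (A t) = 0\<^sub>m (ls ! i) (ls ! j))}"

definition BUT_nonsingular :: "real set \<Rightarrow> nat list \<Rightarrow> mat_fun set" where
  "BUT_nonsingular I ls = {A \<in> BUT I ls. \<forall>t\<in>I. invertible_mat (A t)}"

definition SUT :: "real set \<Rightarrow> nat list \<Rightarrow> mat_fun set" where
  "SUT I ls = {A. mat_fun_on I (sum_list ls) (sum_list ls) A \<and>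
     (\<forall>t\<in>I. \<forall>i<length ls. \<forall>j<length ls. i \<ge> j \<longrightarrow> block ls i j (A t) = 0\<^sub>m (ls ! i) (ls ! j))}"

definition SUT_column :: "real set \<Rightarrow> nat list \<Rightarrow> mat_fun set" where
  "SUT_column I ls = {N \<in> SUT I ls. \<forall>t\<in>I. \<forall>i. Suc i < length ls \<longrightarrow>
     vec_space.rank (ls ! i) (block ls i (Suc i) (N t)) = ls ! Suc i}"

definition N_Ec :: "nat list \<Rightarrow> real mat" where
  "N_Ec ls = mat (sum_list ls) (sum_list ls)
     (\<lambda>(p, q). if \<exists>i r. Suc i < length ls \<and> r < ls ! Suc i \<and>
                     p = offset ls i + r \<and> q = offset ls (Suc i) + r
               then 1 else 0)"

definition mat_fun_inv :: "mat_fun \<Rightarrow> mat_fun" where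
  "mat_fun_inv R = (\<lambda>t. the (mat_inverse (R t)))"

definition four_block_fun :: "mat_fun \<Rightarrow> mat_fun \<Rightarrow> mat_fun \<Rightarrow> mat_fun \<Rightarrow> mat_fun" where
  "four_block_fun A B C D = (\<lambda>t. four_block_mat (A t) (B t) (C t) (D t))"

text \<open>The matrix functions $\mathrm{diag}(I_d, N)$ and $[\Omega, 0; G, H]$.\<close>

definition E_form :: "nat \<Rightarrow> nat \<Rightarrow> mat_fun \<Rightarrow> mat_fun" where
  "E_form d a N = four_block_fun (\<lambda>_. 1\<^sub>m d) (\<lambda>_. 0\<^sub>m d a) (\<lambda>_. 0\<^sub>m a d) N"

definition F_form :: "nat \<Rightarrow> nat \<Rightarrow> mat_fun \<Rightarrow> mat_fun \<Rightarrow> mat_fun \<Rightarrow> mat_fun" where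
  "F_form d a \<Omega> G H = four_block_fun \<Omega> (\<lambda>_. 0\<^sub>m d a) G H"

definition PreSCF :: "real set \<Rightarrow> nat \<Rightarrow> nat list \<Rightarrow> (mat_fun \<times> mat_fun) set" where
  "PreSCF I d ls = {(E, F). let a = sum_list ls in
     (\<forall>t\<in>I. E t = E_form d a (\<lambda>_. N_Ec ls) t) \<and>
     (\<exists>F11 F12 F21 F22.
        mat_fun_on I d d F11 \<and> mat_fun_on I d a F12 \<and>
        mat_fun_on I a d F21 \<and> mat_fun_on I a a F22 \<and>
        (\<forall>t\<in>I. F t = four_block_fun F11 F12 F21 F22 t) \<and>
        F22 \<in> BUT_nonsingular I ls \<and> (\<lambda>t. F21 t * F12 t) \<in> BUT I ls)}"

lemma offset_Suc: "i < length ls \<Longrightarrow> offset ls (Suc i) = offset ls i + ls ! i"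
  by (simp add: offset_def take_Suc_conv_app_nth)

lemma offset_mono: "i \<le> j \<Longrightarrow> offset ls i \<le> offset ls j"
proof (induction rule: dec_induct)
  case (step n)
  then show ?case
    by (cases "n < length ls") (simp_all add: offset_Suc, simp add: offset_def)
qed simp

lemma offset_add_eq_iff:
  assumes "i < length ls" "j < length ls" "r < ls ! i" "s < ls ! j"
  shows "offset ls i + r = offset ls j + s \<longleftrightarrow> i = j \<and> r = s"
proof -
  have "offset ls i + r < offset ls j + s" if "i < j" "i < length ls" "r < ls ! i" for i j r s
    using that offset_mono[of "Suc i" j ls] by (simp add: offset_Suc)
  then show ?thesis
    using assms by (metis add_left_cancel linorder_neqE_nat nat_neq_iff)
qed

lemma offset_add_less:
  assumes "i < length ls" "r < ls ! i"
  shows "offset ls i + r < sum_list ls"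
proof -
  have "offset ls (length ls) = sum_list ls" by (simp add: offset_def)
  then show ?thesis
    using assms offset_mono[of "Suc i" "length ls" ls] by (simp add: offset_Suc)
qed

lemma block_N_Ec:
  assumes "block_sizes ls" "i < length ls" "j < length ls"
  shows "block ls i j (N_Ec ls) =
    (if j = Suc i then 1\<^sub>m (ls ! j) @\<^sub>r 0\<^sub>m (ls ! i - ls ! j) (ls ! j)
     else 0\<^sub>m (ls ! i) (ls ! j))"
proof -
  have ge: "ls ! Suc n \<le> ls ! n" if "Suc n < length ls" for n
    using assms(1) that by (auto simp: block_sizes_def sorted_wrt_iff_nth_less)
  have ent: "N_Ec ls $$ (offset ls i + r, offset ls j + c) = (if j = Suc i \<and> r = c then 1 else 0)"
    if "r < ls ! i" "c < ls ! j" for r c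
  proof -
    have "(\<exists>n s. Suc n < length ls \<and> s < ls ! Suc n \<and> offset ls i + r = offset ls n + s \<and>
            offset ls j + c = offset ls (Suc n) + s) \<longleftrightarrow> j = Suc i \<and> r = c" (is "?L = ?R")
    proof
      assume ?L
      then obtain n s where ns: "Suc n < length ls" "s < ls ! Suc n"
        "offset ls i + r = offset ls n + s" "offset ls j + c = offset ls (Suc n) + s" by blast
      have "i = n \<and> r = s"
        using ns ge[of n] that assms(2) offset_add_eq_iff[of i ls n r s] by simp
      moreover have "j = Suc n \<and> c = s"
        using ns that assms(3) offset_add_eq_iff[of j ls "Suc n" c s] by simp
      ultimately show ?R by simp
    qed (use assms that in auto)
    then show ?thesis
      using that assms by (simp add: N_Ec_def offset_add_less)
  qed
  have ent': "N_Ec ls $$ (offset ls i + r, offset ls (Suc i) + c) = (if r = c then 1 else 0)"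
    if "j = Suc i" "r < ls ! i" "c < ls ! Suc i" for r c
    using ent[of r c] that by simp
  show ?thesis
    using assms(2,3) ge[of i]
    by (intro eq_matI) (auto simp: block_def append_rows_def ent ent')
qed

end

theory Submission
  imports Defs
begin

text \<open>
  Write \<open>J = N_Ec ls\<close>. Completing the columns of each \<open>N\<^bsub>i,i+1\<^esub>\<close> smoothly to a basis gives a
  block upper triangular nonsingular \<open>R\<close> with \<open>R J = N\<close>, and \<open>L = diag(1, R\<inverse>)\<close>, \<open>K = 1\<close> is the first
  equivalence. The completion is possible because for a nonvanishing curve in \<open>\<real>\<^sup>n\<close> a suitable
  constant linear map to \<open>\<real>\<^sup>2\<close> does not vanish along it: a curve is negligible in the plane.

  For the second equivalence, a differential equation \<open>Z = A + N (Z B + Z' B')\<close> with strictly upper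
  triangular \<open>N\<close> is solved by finitely many iterations, each costing one derivative. One such
  equation gives \<open>Y\<close> eliminating \<open>F21\<close>; another gives a nonsingular \<open>K\<close> with \<open>N K = (K + N K') J\<close>, so that
  \<open>(K + N K')\<inverse>\<close> and \<open>K\<close> transform \<open>(N, 1)\<close> into \<open>(J, 1)\<close>.
\<close>

section \<open>Functions of class C^k on an interval\<close>

text \<open>A nonconstant right factor brings its derivative into the second matrix of the pair, so
  \<open>N\<close> and the identity have to be treated together. The demands
  \<open>L * N * K = N_Ec ls\<close> and \<open>L * (K + N * K') = 1\<close> make \<open>L\<close>
  the inverse of \<open>K + N * K'\<close> and leave the equation of the overview for
  \<open>K\<close> alone. Read by columns, it expresses each column of \<open>K\<close> that has a
  successor through the successor column and its own derivative; the other columns are free and are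
  taken from \<open>R\<close>. A solution found by iteration does not show its nonsingularity. That
  comes from the diagonal blocks, where the derivative drops out and K_ii = R_ii diag(K_jj, 1) with
  j = i + 1, a recursion upwards from K_ii = R_ii in the last block. The second equivalence is given
  by a single pair of factors, in which \<open>R\<close> on the left undoes the first one.\<close>

primrec Cn_on :: "nat \<Rightarrow> real set \<Rightarrow> (real \<Rightarrow> real) \<Rightarrow> bool" where
  "Cn_on 0 I f \<longleftrightarrow> continuous_on I f"
| "Cn_on (Suc n) I f \<longleftrightarrow>
     (\<exists>g. (\<forall>t\<in>I. (f has_real_derivative g t) (at t within I)) \<and> Cn_on n I g)"

lemma has_real_derivative_cong_on:
  assumes "\<forall>t\<in>I. f t = g t" "t \<in> I" "(f has_real_derivative D) (at t within I)"
  shows "(g has_real_derivative D) (at t within I)"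
  using assms has_field_derivative_transform_within[of f D t I 1 g] by auto

lemma Cn_on_cong:
  assumes "\<forall>t\<in>I. f t = g t" "Cn_on n I f"
  shows "Cn_on n I g"
proof (cases n)
  case 0
  then show ?thesis using assms by (simp cong: continuous_on_cong)
next
  case (Suc m)
  then show ?thesis using assms has_real_derivative_cong_on[OF assms(1)]
    by (metis Cn_on.simps(2))
qed

lemma Cn_on_SucD: "Cn_on (Suc n) I f \<Longrightarrow> Cn_on n I f"
proof (induction n arbitrary: f)
  case 0
  then show ?case
    unfolding Cn_on.simps continuous_on_eq_continuous_within by (meson DERIV_continuous)
next
  case (Suc n)
  then obtain g where "\<forall>t\<in>I. (f has_real_derivative g t) (at t within I)" "Cn_on (Suc n) I g"
    by auto
  with Suc.IH show ?case by auto
qed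

lemma Cn_on_const: "Cn_on n I (\<lambda>_. c)"
  by (induction n arbitrary: c) (auto intro: exI[of _ "\<lambda>_. 0"])

lemma Cn_on_add: "Cn_on n I f \<Longrightarrow> Cn_on n I g \<Longrightarrow> Cn_on n I (\<lambda>t. f t + g t)"
proof (induction n arbitrary: f g)
  case (Suc n)
  obtain f' where f': "\<forall>t\<in>I. (f has_real_derivative f' t) (at t within I)" "Cn_on n I f'"
    using Suc.prems(1) by auto
  obtain g' where g': "\<forall>t\<in>I. (g has_real_derivative g' t) (at t within I)" "Cn_on n I g'"
    using Suc.prems(2) by auto
  show ?case
    using f' g' Suc.IH[of f' g']
    by (auto intro!: exI[of _ "\<lambda>t. f' t + g' t"] DERIV_add)
qed (auto intro: continuous_intros)

lemma Cn_on_mult: "Cn_on n I f \<Longrightarrow> Cn_on n I g \<Longrightarrow> Cn_on n I (\<lambda>t. f t * g t)"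
proof (induction n arbitrary: f g)
  case (Suc n)
  obtain f' where f': "\<forall>t\<in>I. (f has_real_derivative f' t) (at t within I)" "Cn_on n I f'"
    using Suc.prems(1) by auto
  obtain g' where g': "\<forall>t\<in>I. (g has_real_derivative g' t) (at t within I)" "Cn_on n I g'"
    using Suc.prems(2) by auto
  have "Cn_on n I (\<lambda>t. f' t * g t + f t * g' t)"
    using f' g' Suc.prems by (intro Cn_on_add Suc.IH Cn_on_SucD[of n I f] Cn_on_SucD[of n I g]) auto
  moreover have "((\<lambda>t. f t * g t) has_real_derivative f' t * g t + f t * g' t) (at t within I)"
    if "t \<in> I" for t
    using DERIV_mult[of f "f' t" t I g "g' t"] f'(1) g'(1) that by (simp add: algebra_simps)
  ultimately show ?case by (auto intro!: exI[of _ "\<lambda>t. f' t * g t + f t * g' t"])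
qed (auto intro: continuous_intros)

lemma Cn_on_inverse:
  "Cn_on n I f \<Longrightarrow> \<forall>t\<in>I. f t \<noteq> 0 \<Longrightarrow> Cn_on n I (\<lambda>t. inverse (f t))"
proof (induction n)
  case (Suc n)
  obtain f' where f': "\<forall>t\<in>I. (f has_real_derivative f' t) (at t within I)" "Cn_on n I f'"
    using Suc.prems(1) by auto
  let ?g = "\<lambda>t. -1 * (inverse (f t) * (f' t * inverse (f t)))"
  have "Cn_on n I ?g"
    using f' Suc.prems Suc.IH Cn_on_SucD[of n I f] by (intro Cn_on_mult Cn_on_const) auto
  moreover have "((\<lambda>t. inverse (f t)) has_real_derivative ?g t) (at t within I)" if "t \<in> I" for t
    using DERIV_inverse'[of f "f' t" t I] f'(1) Suc.prems(2) that by (simp add: mult.assoc)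
  ultimately show ?case by (auto intro!: exI[of _ ?g])
qed (auto intro: continuous_intros)

section \<open>Derivatives relative to a set without isolated points\<close>

definition deriv_on :: "real set \<Rightarrow> (real \<Rightarrow> real) \<Rightarrow> real \<Rightarrow> real" where
  "deriv_on I f t = vector_derivative f (at t within I)"

text \<open>Without isolated points the derivative within \<open>I\<close> is unique, so a
  derivative known only to exist can be identified with \<open>deriv_on\<close>.\<close>

definition perfect :: "real set \<Rightarrow> bool" where
  "perfect I \<longleftrightarrow> (\<forall>t\<in>I. at t within I \<noteq> bot)"

lemma perfect_interval:
  assumes "is_interval I" "interior I \<noteq> {}"
  shows "perfect I"
proof -
  have "t islimpt I" if "t \<in> I" for t
  proof (rule connected_imp_perfect)
    show "connected I" using assms(1) by (simp add: is_interval_connected)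
    show "I \<noteq> {x}" for x using assms(2) by auto
  qed fact
  then show ?thesis by (simp add: perfect_def trivial_limit_within)
qed

lemma deriv_on_eq:
  assumes "perfect I" "t \<in> I" "(f has_real_derivative D) (at t within I)"
  shows "deriv_on I f t = D"
  using assms unfolding deriv_on_def perfect_def
  by (auto intro!: vector_derivative_within simp: has_real_derivative_iff_has_vector_derivative)

text \<open>This also covers points where no derivative exists: the value is then chosen from a
  predicate, and both functions give the same predicate.\<close>

lemma deriv_on_cong:
  assumes "\<forall>t\<in>I. f t = g t" "t \<in> I"
  shows "deriv_on I f t = deriv_on I g t"
proof -
  have "(f has_vector_derivative D) (at t within I) \<longleftrightarrow> (g has_vector_derivative D) (at t within I)" for D
    using has_real_derivative_cong_on[of I f g t D] has_real_derivative_cong_on[of I g f t D] assms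
    by (auto simp: has_real_derivative_iff_has_vector_derivative)
  then show ?thesis by (simp add: deriv_on_def vector_derivative_def)
qed

lemma Cn_on_Suc_deriv_on:
  assumes "perfect I" "Cn_on (Suc n) I f"
  shows "\<forall>t\<in>I. (f has_real_derivative deriv_on I f t) (at t within I)" "Cn_on n I (deriv_on I f)"
proof -
  obtain g where g: "\<forall>t\<in>I. (f has_real_derivative g t) (at t within I)" "Cn_on n I g"
    using assms(2) by auto
  have "\<forall>t\<in>I. g t = deriv_on I f t" using g(1) deriv_on_eq[OF assms(1)] by metis
  then show "\<forall>t\<in>I. (f has_real_derivative deriv_on I f t) (at t within I)" "Cn_on n I (deriv_on I f)"
    using g Cn_on_cong[of I g "deriv_on I f" n] by auto
qed

text \<open>\<open>Ck_on\<close> asks for one sequence of derivatives serving all orders, also for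
  infinite \<open>k\<close>, whereas \<open>Cn_on\<close> yields witnesses order by order.
  Uniqueness of derivatives glues them: the iterates of \<open>deriv_on\<close> fit every order at
  once. In the recursive form, products and reciprocals go by induction on the order, without a
  Leibniz formula.\<close>

lemma Ck_on_iff_Cn_on:
  assumes "perfect I"
  shows "Ck_on k I f \<longleftrightarrow> (\<forall>n. enat n \<le> k \<longrightarrow> Cn_on n I f)"
proof
  assume "Ck_on k I f"
  then obtain D where D: "\<forall>t\<in>I. D 0 t = f t"
    "\<And>n t. enat n < k \<Longrightarrow> t \<in> I \<Longrightarrow> (D n has_real_derivative D (Suc n) t) (at t within I)"
    "\<And>n. enat n \<le> k \<Longrightarrow> continuous_on I (D n)"
    unfolding Ck_on_def by blast
  have "Cn_on n I (D m)" if "enat (m + n) \<le> k" for n m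
    using that
  proof (induction n arbitrary: m)
    case 0
    then show ?case using D(3) by simp
  next
    case (Suc n)
    have "enat m < k" by (rule less_le_trans[OF _ Suc.prems]) simp
    then show ?case using D(2)[of m] Suc.IH[of "Suc m"] Suc.prems by auto
  qed
  from this[of 0] show "\<forall>n. enat n \<le> k \<longrightarrow> Cn_on n I f"
    using Cn_on_cong[OF D(1)] by simp
next
  assume *: "\<forall>n. enat n \<le> k \<longrightarrow> Cn_on n I f"
  have iter: "Cn_on n I ((deriv_on I ^^ m) f)" if "Cn_on (m + n) I f" for m n
    using that
  proof (induction m arbitrary: n)
    case (Suc m)
    then have "Cn_on (Suc n) I ((deriv_on I ^^ m) f)" by (metis add_Suc_shift)
    from Cn_on_Suc_deriv_on(2)[OF assms this] show ?case by simp
  qed simp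
  have "((deriv_on I ^^ n) f has_real_derivative (deriv_on I ^^ Suc n) f t) (at t within I)"
    if "enat n < k" "t \<in> I" for n t
  proof -
    have "enat (n + Suc 0) \<le> k" using that(1) by (metis Suc_ile_eq add.right_neutral add_Suc_right)
    then have "Cn_on (Suc 0) I ((deriv_on I ^^ n) f)" using * iter[of n "Suc 0"] by blast
    from Cn_on_Suc_deriv_on(1)[OF assms this] that(2) show ?thesis by simp
  qed
  moreover have "continuous_on I ((deriv_on I ^^ n) f)" if "enat n \<le> k" for n
    using * iter[of n 0] that by simp
  ultimately show "Ck_on k I f"
    unfolding Ck_on_def by (intro exI[of _ "\<lambda>n. (deriv_on I ^^ n) f"]) auto
qed

lemma Ck_on_mono: "perfect I \<Longrightarrow> Ck_on k I f \<Longrightarrow> j \<le> k \<Longrightarrow> Ck_on j I f"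
  by (auto simp: Ck_on_iff_Cn_on)

lemma Ck_on_cong: "Ck_on k I f \<Longrightarrow> \<forall>t\<in>I. f t = g t \<Longrightarrow> Ck_on k I g"
  by (auto simp: Ck_on_def)

lemma Ck_on_const: "perfect I \<Longrightarrow> Ck_on k I (\<lambda>_. c)"
  by (simp add: Ck_on_iff_Cn_on Cn_on_const)

lemma Ck_on_add: "perfect I \<Longrightarrow> Ck_on k I f \<Longrightarrow> Ck_on k I g \<Longrightarrow> Ck_on k I (\<lambda>t. f t + g t)"
  by (simp add: Ck_on_iff_Cn_on Cn_on_add)

lemma Ck_on_mult: "perfect I \<Longrightarrow> Ck_on k I f \<Longrightarrow> Ck_on k I g \<Longrightarrow> Ck_on k I (\<lambda>t. f t * g t)"
  by (simp add: Ck_on_iff_Cn_on Cn_on_mult)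

lemma Ck_on_inverse:
  "perfect I \<Longrightarrow> Ck_on k I f \<Longrightarrow> \<forall>t\<in>I. f t \<noteq> 0 \<Longrightarrow> Ck_on k I (\<lambda>t. inverse (f t))"
  by (simp add: Ck_on_iff_Cn_on Cn_on_inverse)

lemma Ck_on_uminus: "perfect I \<Longrightarrow> Ck_on k I f \<Longrightarrow> Ck_on k I (\<lambda>t. - f t)"
  using Ck_on_mult[OF _ Ck_on_const[of I k "-1"]] by simp

lemma Ck_on_diff: "perfect I \<Longrightarrow> Ck_on k I f \<Longrightarrow> Ck_on k I g \<Longrightarrow> Ck_on k I (\<lambda>t. f t - g t)"
  using Ck_on_add[OF _ _ Ck_on_uminus] by simp

lemma Ck_on_sum:
  "perfect I \<Longrightarrow> (\<And>i. i \<in> S \<Longrightarrow> Ck_on k I (f i)) \<Longrightarrow> Ck_on k I (\<lambda>t. \<Sum>i\<in>S. f i t)"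
  by (induction S rule: infinite_finite_induct) (auto intro: Ck_on_const Ck_on_add)

lemma Ck_on_prod:
  "perfect I \<Longrightarrow> (\<And>i. i \<in> S \<Longrightarrow> Ck_on k I (f i)) \<Longrightarrow> Ck_on k I (\<lambda>t. \<Prod>i\<in>S. f i t)"
  by (induction S rule: infinite_finite_induct) (auto intro: Ck_on_const Ck_on_mult)

lemma Ck_on_deriv_on:
  assumes "perfect I" "Ck_on (k + 1) I f"
  shows "Ck_on k I (deriv_on I f)"
  unfolding Ck_on_iff_Cn_on[OF assms(1)]
proof (intro allI impI)
  fix n assume "enat n \<le> k"
  then have "enat (Suc n) \<le> k + 1" by (metis add_right_mono eSuc_enat plus_1_eSuc(2))
  then show "Cn_on n I (deriv_on I f)"
    using assms Ck_on_iff_Cn_on Cn_on_Suc_deriv_on(2) by blast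
qed

lemma Ck_on_imp_differentiable_on:
  assumes "perfect I" "1 \<le> k" "Ck_on k I f"
  shows "f differentiable_on I"
proof -
  have "enat (Suc 0) \<le> k" using assms(2) by (simp add: one_enat_def)
  then have "Cn_on (Suc 0) I f" using assms Ck_on_iff_Cn_on by blast
  then show ?thesis
    by (auto simp: differentiable_on_def has_field_derivative_def differentiable_def)
qed

section \<open>Matrices and vectors of C^k functions\<close>

lemma index_mult_mat_sum:
  assumes "A \<in> carrier_mat n m" "B \<in> carrier_mat m l" "i < n" "j < l"
  shows "(A * B) $$ (i, j) = (\<Sum>p<m. A $$ (i, p) * B $$ (p, j))"
  using assms by (auto simp: scalar_prod_def atLeast0LessThan intro!: sum.cong)

lemma index_mult_mat_vec_sum:
  assumes "A \<in> carrier_mat n m" "x \<in> carrier_vec m" "i < n"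
  shows "vec_index (A *\<^sub>v x) i = (\<Sum>p<m. A $$ (i, p) * vec_index x p)"
  using assms by (auto simp: scalar_prod_def atLeast0LessThan intro!: sum.cong)

lemma Ck_mat_funI:
  assumes "\<And>t. t \<in> I \<Longrightarrow> A t \<in> carrier_mat n m"
    and "\<And>i j. i < n \<Longrightarrow> j < m \<Longrightarrow> Ck_on k I (\<lambda>t. A t $$ (i, j))"
  shows "Ck_mat_fun k I n m A"
  using assms by (simp add: Ck_mat_fun_def mat_fun_on_def)

lemma Ck_mat_funD:
  assumes "Ck_mat_fun k I n m A"
  shows "t \<in> I \<Longrightarrow> A t \<in> carrier_mat n m"
    and "i < n \<Longrightarrow> j < m \<Longrightarrow> Ck_on k I (\<lambda>t. A t $$ (i, j))"
  using assms by (auto simp: Ck_mat_fun_def mat_fun_on_def)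

lemma Ck_mat_fun_mono:
  "perfect I \<Longrightarrow> Ck_mat_fun k I n m A \<Longrightarrow> j \<le> k \<Longrightarrow> Ck_mat_fun j I n m A"
  by (auto simp: Ck_mat_fun_def intro: Ck_on_mono)

lemma Ck_mat_fun_const: "perfect I \<Longrightarrow> A \<in> carrier_mat n m \<Longrightarrow> Ck_mat_fun k I n m (\<lambda>_. A)"
  by (auto simp: Ck_mat_fun_def mat_fun_on_def intro: Ck_on_const)

lemma Ck_mat_fun_mult:
  assumes "perfect I" "Ck_mat_fun k I n m A" "Ck_mat_fun k I m l B"
  shows "Ck_mat_fun k I n l (\<lambda>t. A t * B t)"
proof (rule Ck_mat_funI)
  show "A t * B t \<in> carrier_mat n l" if "t \<in> I" for t
    using assms(2,3)[THEN Ck_mat_funD(1), OF that] by auto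
  show "Ck_on k I (\<lambda>t. (A t * B t) $$ (i, j))" if "i < n" "j < l" for i j
  proof (rule Ck_on_cong)
    show "Ck_on k I (\<lambda>t. \<Sum>p<m. A t $$ (i, p) * B t $$ (p, j))"
      using assms that by (intro Ck_on_sum Ck_on_mult Ck_mat_funD(2)) auto
    show "\<forall>t\<in>I. (\<Sum>p<m. A t $$ (i, p) * B t $$ (p, j)) = (A t * B t) $$ (i, j)"
      using index_mult_mat_sum[OF assms(2,3)[THEN Ck_mat_funD(1)] that] by simp
  qed
qed

lemma Ck_mat_fun_add:
  assumes "perfect I" "Ck_mat_fun k I n m A" "Ck_mat_fun k I n m B"
  shows "Ck_mat_fun k I n m (\<lambda>t. A t + B t)"
proof (rule Ck_mat_funI)
  show "A t + B t \<in> carrier_mat n m" if "t \<in> I" for t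
    using assms(2,3)[THEN Ck_mat_funD(1), OF that] by auto
  show "Ck_on k I (\<lambda>t. (A t + B t) $$ (i, j))" if "i < n" "j < m" for i j
    by (rule Ck_on_cong[OF Ck_on_add[OF assms(1) assms(2,3)[THEN Ck_mat_funD(2)[OF _ that]]]])
      (use that assms(2,3)[THEN Ck_mat_funD(1), THEN carrier_matD(1)]
        assms(2,3)[THEN Ck_mat_funD(1), THEN carrier_matD(2)] in simp)
qed

lemma Ck_mat_fun_uminus:
  assumes "perfect I" "Ck_mat_fun k I n m A"
  shows "Ck_mat_fun k I n m (\<lambda>t. - A t)"
proof (rule Ck_mat_funI)
  show "- A t \<in> carrier_mat n m" if "t \<in> I" for t
    using that assms(2)[THEN Ck_mat_funD(1)] by auto
  show "Ck_on k I (\<lambda>t. (- A t) $$ (i, j))" if "i < n" "j < m" for i j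
    by (rule Ck_on_cong[OF Ck_on_uminus[OF assms(1) Ck_mat_funD(2)[OF assms(2) that]]])
      (use that in \<open>simp add: carrier_matD[OF Ck_mat_funD(1)[OF assms(2)]]\<close>)
qed

lemma index_four_block_fun:
  assumes "A t \<in> carrier_mat n m" "B t \<in> carrier_mat n m'" "C t \<in> carrier_mat n' m" "D t \<in> carrier_mat n' m'"
    and "i < n + n'" "j < m + m'"
  shows "four_block_fun A B C D t $$ (i, j) =
    (if i < n then if j < m then A t $$ (i, j) else B t $$ (i, j - m)
     else if j < m then C t $$ (i - n, j) else D t $$ (i - n, j - m))"
  using assms by (simp add: four_block_fun_def)

lemma Ck_mat_fun_four_block:
  assumes "Ck_mat_fun k I n m A" "Ck_mat_fun k I n m' B" "Ck_mat_fun k I n' m C" "Ck_mat_fun k I n' m' D"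
  shows "Ck_mat_fun k I (n + n') (m + m') (four_block_fun A B C D)"
proof (rule Ck_mat_funI)
  note c = assms[THEN Ck_mat_funD(1)]
  show "four_block_fun A B C D t \<in> carrier_mat (n + n') (m + m')" if "t \<in> I" for t
    using c[OF that] by (simp add: four_block_fun_def)
  show "Ck_on k I (\<lambda>t. four_block_fun A B C D t $$ (i, j))" if ij: "i < n + n'" "j < m + m'" for i j
  proof (rule Ck_on_cong)
    have "i - n < n'" if "\<not> i < n" using ij that by simp
    moreover have "j - m < m'" if "\<not> j < m" using ij that by simp
    ultimately show "Ck_on k I (\<lambda>t. if i < n then if j < m then A t $$ (i, j) else B t $$ (i, j - m)
         else if j < m then C t $$ (i - n, j) else D t $$ (i - n, j - m))"
      using assms by (cases "i < n"; cases "j < m") (simp_all add: Ck_mat_funD(2))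
    show "\<forall>t\<in>I. (if i < n then if j < m then A t $$ (i, j) else B t $$ (i, j - m)
         else if j < m then C t $$ (i - n, j) else D t $$ (i - n, j - m)) = four_block_fun A B C D t $$ (i, j)"
      using index_four_block_fun[where A = A and B = B and C = C and D = D, OF c ij] by metis
  qed
qed

lemma index_mat_fun_deriv:
  "i < n \<Longrightarrow> j < m \<Longrightarrow> mat_fun_deriv I n m A t $$ (i, j) = deriv_on I (\<lambda>s. A s $$ (i, j)) t"
  by (simp add: mat_fun_deriv_def deriv_on_def)

lemma mat_fun_deriv_carrier: "mat_fun_deriv I n m A t \<in> carrier_mat n m"
  by (simp add: mat_fun_deriv_def)

lemma Ck_mat_fun_deriv:
  assumes "perfect I" "Ck_mat_fun (k + 1) I n m A"
  shows "Ck_mat_fun k I n m (mat_fun_deriv I n m A)"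
proof (rule Ck_mat_funI)
  show "mat_fun_deriv I n m A t \<in> carrier_mat n m" for t by (rule mat_fun_deriv_carrier)
  show "Ck_on k I (\<lambda>t. mat_fun_deriv I n m A t $$ (i, j))" if "i < n" "j < m" for i j
    by (rule Ck_on_cong[OF Ck_on_deriv_on[OF assms(1) Ck_mat_funD(2)[OF assms(2) that]]])
      (simp add: that index_mat_fun_deriv)
qed

section \<open>Determinants and inverses of smooth matrix functions\<close>

lemma Ck_on_det:
  assumes "perfect I" "Ck_mat_fun k I n n A"
  shows "Ck_on k I (\<lambda>t. det (A t))"
proof (rule Ck_on_cong)
  let ?f = "\<lambda>t. \<Sum>p | p permutes {0..<n}. signof p * (\<Prod>i = 0..<n. A t $$ (i, p i))"
  show "Ck_on k I ?f"
    using assms(1) Ck_mat_funD(2)[OF assms(2)]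
    by (intro Ck_on_sum Ck_on_mult Ck_on_const Ck_on_prod) (auto simp: permutes_in_image)
  show "\<forall>t\<in>I. ?f t = det (A t)"
    using det_def'[OF Ck_mat_funD(1)[OF assms(2)]] by simp
qed

lemma Ck_mat_fun_mat_delete:
  assumes "Ck_mat_fun k I n n A" "i < n" "j < n"
  shows "Ck_mat_fun k I (n - 1) (n - 1) (\<lambda>t. mat_delete (A t) i j)"
proof (rule Ck_mat_funI)
  show "mat_delete (A t) i j \<in> carrier_mat (n - 1) (n - 1)" if "t \<in> I" for t
    using Ck_mat_funD(1)[OF assms(1) that] by (rule mat_delete_carrier)
  show "Ck_on k I (\<lambda>t. mat_delete (A t) i j $$ (p, q))" if "p < n - 1" "q < n - 1" for p q
  proof (rule Ck_on_cong)
    show "Ck_on k I (\<lambda>t. A t $$ (if p < i then p else Suc p, if q < j then q else Suc q))"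
      using that assms by (intro Ck_mat_funD(2)) auto
    show "\<forall>t\<in>I. A t $$ (if p < i then p else Suc p, if q < j then q else Suc q)
        = mat_delete (A t) i j $$ (p, q)"
      using that Ck_mat_funD(1)[OF assms(1)]
      by (auto simp: mat_delete_def carrier_matD[OF Ck_mat_funD(1)[OF assms(1)]])
  qed
qed

text \<open>Cramer's rule: cofactors are determinants in the entries of \<open>A\<close>, and the
  only division is by the nonvanishing determinant.\<close>

lemma Ck_mat_fun_inverse_exists:
  assumes I: "perfect I" and A: "Ck_mat_fun k I n n A" and "\<forall>t\<in>I. det (A t) \<noteq> 0"
  shows "\<exists>B. Ck_mat_fun k I n n B \<and> (\<forall>t\<in>I. A t * B t = 1\<^sub>m n \<and> B t * A t = 1\<^sub>m n)"
proof -
  let ?B = "\<lambda>t. inverse (det (A t)) \<cdot>\<^sub>m adj_mat (A t)"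
  note cA = Ck_mat_funD(1)[OF A]
  have "Ck_mat_fun k I n n ?B"
  proof (rule Ck_mat_funI)
    show "?B t \<in> carrier_mat n n" if "t \<in> I" for t
      using adj_mat(1)[OF cA[OF that]] by simp
    show "Ck_on k I (\<lambda>t. ?B t $$ (i, j))" if ij: "i < n" "j < n" for i j
    proof (rule Ck_on_cong)
      show "Ck_on k I (\<lambda>t. inverse (det (A t)) * ((-1) ^ (j + i) * det (mat_delete (A t) j i)))"
        using assms ij
        by (intro Ck_on_mult Ck_on_inverse Ck_on_const Ck_on_det[OF I A]
            Ck_on_det[OF I Ck_mat_fun_mat_delete[OF A]]) auto
      show "\<forall>t\<in>I. inverse (det (A t)) * ((-1) ^ (j + i) * det (mat_delete (A t) j i)) = ?B t $$ (i, j)"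
        using ij by (auto simp: adj_mat_def cofactor_def cA[THEN carrier_matD(1)] cA[THEN carrier_matD(2)])
    qed
  qed
  moreover have "A t * ?B t = 1\<^sub>m n" if "t \<in> I" for t
  proof -
    have "A t * ?B t = inverse (det (A t)) \<cdot>\<^sub>m (det (A t) \<cdot>\<^sub>m 1\<^sub>m n)"
      using mult_smult_distrib[OF cA[OF that] adj_mat(1)[OF cA[OF that]]] adj_mat(2)[OF cA[OF that]]
      by simp
    then show ?thesis using assms(3) that by (auto intro!: eq_matI)
  qed
  moreover have "?B t * A t = 1\<^sub>m n" if "t \<in> I" for t
  proof -
    have "?B t * A t = inverse (det (A t)) \<cdot>\<^sub>m (det (A t) \<cdot>\<^sub>m 1\<^sub>m n)"
      using mult_smult_assoc_mat[OF adj_mat(1)[OF cA[OF that]] cA[OF that]] adj_mat(3)[OF cA[OF that]]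
      by simp
    then show ?thesis using assms(3) that by (auto intro!: eq_matI)
  qed
  ultimately show ?thesis by blast
qed

lemma det_nonzeroI:
  fixes A :: "real mat"
  assumes "A \<in> carrier_mat n n"
    and "\<And>x. x \<in> carrier_vec n \<Longrightarrow> A *\<^sub>v x = 0\<^sub>v n \<Longrightarrow> x = 0\<^sub>v n"
  shows "det A \<noteq> 0"
  using assms det_0_iff_vec_prod_zero by blast

lemma mult_left_inverse_vec_eq_0:
  fixes A :: "real mat"
  assumes "A \<in> carrier_mat n n" "B \<in> carrier_mat n n" "B * A = 1\<^sub>m n"
    and "x \<in> carrier_vec n" "A *\<^sub>v x = 0\<^sub>v n"
  shows "x = 0\<^sub>v n"
proof -
  have "x = (B * A) *\<^sub>v x" using assms by simp
  also have "\<dots> = B *\<^sub>v (A *\<^sub>v x)" using assms(1,2,4) by (intro assoc_mult_mat_vec)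
  also have "\<dots> = B *\<^sub>v 0\<^sub>v n" using assms(5) by simp
  also have "\<dots> = 0\<^sub>v n" using assms(2) by auto
  finally show ?thesis .
qed

section \<open>Completion of a matrix function of full column rank\<close>

lemma vec_eq_0_iff_index: "x \<in> carrier_vec n \<Longrightarrow> x = 0\<^sub>v n \<longleftrightarrow> (\<forall>i<n. vec_index x i = 0)"
  by (auto intro!: eq_vecI)

lemma sum_lessThan_split:
  fixes f :: "nat \<Rightarrow> real"
  shows "(\<Sum>i<a + b. f i) = (\<Sum>i<a. f i) + (\<Sum>i<b. f (a + i))"
  by (induction b) simp_all

text \<open>Rank is governed by independent subsets of the set of columns, in which repeated columns
  collapse. Counting first shows the columns to be distinct; only then does a kernel vector become a
  linear dependence within that set.\<close>

lemma full_col_rank_injective: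
  fixes A :: "real mat"
  assumes A: "A \<in> carrier_mat n m" and rank: "vec_space.rank n A = m"
    and x: "x \<in> carrier_vec m" "A *\<^sub>v x = 0\<^sub>v n"
  shows "x = 0\<^sub>v m"
proof (rule ccontr)
  interpret vec_space "TYPE(real)" n .
  assume x0: "x \<noteq> 0\<^sub>v m"
  obtain S where S: "maximal S (\<lambda>T. T \<subseteq> set (cols A) \<and> lin_indpt T)"
    using maximal_exists[of "\<lambda>T. T \<subseteq> set (cols A) \<and> lin_indpt T" "card (set (cols A))" "{}"]
    by (meson List.finite_set card_mono empty_iff empty_subsetI finite_lin_indpt2 rev_finite_subset)
  have "card S \<le> card (set (cols A))" using S by (simp add: card_mono maximal_def)
  moreover have "card S = m" using rank_card_indpt[OF A S] rank by simp
  ultimately have "distinct (cols A)"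
    using A card_length[of "cols A"] by (intro card_distinct) simp
  then show False
    using lin_depI[OF A x(1) x0 x(2)] full_rank_lin_indpt[OF A rank] by blast
qed

text \<open>The curve \<open>(f / h, g / h)\<close> is negligible in the plane, so it misses some point \<open>(- a, - b)\<close>.\<close>

lemma curve_avoids_point:
  assumes I: "perfect I" and k: "1 \<le> k" and C: "Ck_on k I f" "Ck_on k I g" "Ck_on k I h"
  shows "\<exists>a b. \<forall>t\<in>I. h t \<noteq> 0 \<longrightarrow> f t + a * h t \<noteq> 0 \<or> g t + b * h t \<noteq> 0"
proof -
  define S where "S = {t\<in>I. h t \<noteq> 0}"
  define c where "c = (\<lambda>t. (f t / h t, g t / h t))"
  have "f differentiable_on S" "g differentiable_on S" "h differentiable_on S"
    using C[THEN Ck_on_imp_differentiable_on[OF I k]]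
    by (auto intro: differentiable_on_subset simp: S_def)
  then have "c differentiable_on S"
    unfolding c_def differentiable_on_def
    by (auto intro!: differentiable_Pair differentiable_divide simp: S_def)
  then have "negligible (c ` S)"
    by (intro negligible_differentiable_image_lowdim) simp_all
  then have "c ` S \<noteq> UNIV" using non_negligible_UNIV by metis
  then obtain u v where uv: "(u, v) \<notin> c ` S" by auto
  have "f t + (-u) * h t \<noteq> 0 \<or> g t + (-v) * h t \<noteq> 0" if "t \<in> I" "h t \<noteq> 0" for t
  proof (rule ccontr)
    assume "\<not> ?thesis"
    then have "c t = (u, v)" using that by (simp add: c_def)
    then show False using uv that by (force simp: S_def)
  qed
  then show ?thesis by blast
qed

text \<open>The last coordinate is absorbed into the first two with constant weights
  \<open>a\<close> and \<open>b\<close>. Where it is nonzero, the avoided point keeps the new first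
  pair from vanishing; where it is zero, nothing changes and some remaining coordinate is nonzero.
  The values of \<open>p\<close> and \<open>q\<close> at 0 and 1 present the map to the plane as the
  identity on the first two coordinates, which is what later makes the transformation matrix
  invertible.\<close>

lemma plane_projection_nonvanishing:
  fixes v :: "nat \<Rightarrow> real \<Rightarrow> real"
  assumes I: "perfect I" and k: "1 \<le> k"
    and "\<forall>i<n + 2. Ck_on k I (v i)" and "\<forall>t\<in>I. \<exists>i<n + 2. v i t \<noteq> 0"
  shows "\<exists>p q. p 0 = 1 \<and> p 1 = 0 \<and> q 0 = 0 \<and> q 1 = 1 \<and>
    (\<forall>t\<in>I. (\<Sum>i<n + 2. p i * v i t) \<noteq> 0 \<or> (\<Sum>i<n + 2. q i * v i t) \<noteq> 0)"
  using assms(3,4)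
proof (induction n arbitrary: v)
  case 0
  have "v 0 t \<noteq> 0 \<or> v 1 t \<noteq> 0" if "t \<in> I" for t
    using 0(2) that less_2_cases by (metis One_nat_def add_0)
  then show ?case
    by (intro exI[of _ "\<lambda>i. if i = 0 then 1 else 0"] exI[of _ "\<lambda>i. if i = 0 then 0 else 1"])
      (auto simp: numeral_2_eq_2)
next
  case (Suc n)
  let ?h = "v (n + 2)"
  obtain a b where ab: "\<forall>t\<in>I. ?h t \<noteq> 0 \<longrightarrow> v 0 t + a * ?h t \<noteq> 0 \<or> v 1 t + b * ?h t \<noteq> 0"
    using curve_avoids_point[OF I k, of "v 0" "v 1" ?h] Suc.prems(1) by auto
  define w where "w = v(0 := \<lambda>t. v 0 t + a * ?h t, 1 := \<lambda>t. v 1 t + b * ?h t)"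
  have "\<forall>i<n + 2. Ck_on k I (w i)"
    unfolding w_def using Suc.prems(1) by (auto intro!: Ck_on_add Ck_on_mult Ck_on_const I)
  moreover have "\<exists>i<n + 2. w i t \<noteq> 0" if t: "t \<in> I" for t
  proof (cases "?h t = 0")
    case True
    obtain i where i: "i < Suc n + 2" "v i t \<noteq> 0" using Suc.prems(2) t by blast
    have "i \<noteq> n + 2" using i True by auto
    then have "i < n + 2" using i by simp
    moreover have "w i t \<noteq> 0" using i True by (auto simp: w_def)
    ultimately show ?thesis by blast
  next
    case False
    then have "w 0 t \<noteq> 0 \<or> w 1 t \<noteq> 0" using ab t by (simp add: w_def)
    then show ?thesis by (metis add_2_eq_Suc' zero_less_Suc less_add_Suc2 One_nat_def Suc_less_eq)
  qed
  ultimately obtain p q where pq: "p 0 = 1" "p 1 = 0" "q 0 = 0" "q 1 = 1"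
    "\<forall>t\<in>I. (\<Sum>i<n + 2. p i * w i t) \<noteq> 0 \<or> (\<Sum>i<n + 2. q i * w i t) \<noteq> 0"
    using Suc.IH[of w] by blast
  have 2: "(\<Sum>i<n + 2. f i) = f 0 + f 1 + (\<Sum>i<n. f (2 + i))" for f :: "nat \<Rightarrow> real"
    using sum_lessThan_split[of f 2 n] by (simp add: numeral_2_eq_2 add.commute)
  \<comment> \<open>Since \<open>p\<close> and \<open>q\<close> restrict to the two unit vectors on
    the indices 0 and 1, replacing \<open>v\<close> by \<open>w\<close> adds exactly
    \<open>a\<close> and \<open>b\<close> times the last coordinate.\<close>
  let ?p = "p(n + 2 := a)" and ?q = "q(n + 2 := b)"
  have "(\<Sum>i<Suc n + 2. ?p i * v i t) = (\<Sum>i<n + 2. p i * w i t)"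
    "(\<Sum>i<Suc n + 2. ?q i * v i t) = (\<Sum>i<n + 2. q i * w i t)" for t
    unfolding add_Suc sum.lessThan_Suc 2 using pq by (simp_all add: w_def)
  then show ?case
    using pq by (intro exI[of _ ?p] exI[of _ ?q]) simp
qed

text \<open>With at least two coordinates, the constant projection gives a planar curve (w, z)
  without zeros, and a nonzero planar vector is carried to (1, 0) by an explicit smooth similarity.
  A single coordinate has no plane to project to, but it is itself nonvanishing and is divided
  out.\<close>

lemma column_to_unit_vector:
  fixes v :: "nat \<Rightarrow> real \<Rightarrow> real"
  assumes I: "perfect I" and k: "1 \<le> k" and n: "0 < n"
    and v: "\<forall>i<n. Ck_on k I (v i)" "\<forall>t\<in>I. \<exists>i<n. v i t \<noteq> 0"
  shows "\<exists>A. Ck_mat_fun k I n n A \<and> (\<forall>t\<in>I. det (A t) \<noteq> 0 \<and>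
    (\<forall>i<n. (\<Sum>j<n. A t $$ (i, j) * v j t) = (if i = 0 then 1 else 0)))"
proof (cases "n = 1")
  case True
  let ?A = "\<lambda>t. mat 1 1 (\<lambda>_. inverse (v 0 t))"
  have v0: "\<forall>t\<in>I. v 0 t \<noteq> 0" using v(2) True by auto
  then have "Ck_mat_fun k I n n ?A"
    using True v(1) by (intro Ck_mat_funI) (auto intro: Ck_on_inverse I)
  moreover have "det (?A t) \<noteq> 0" if "t \<in> I" for t
    using v0 that by (subst det_single) auto
  ultimately show ?thesis
    using v0 True by (intro exI[of _ ?A]) simp
next
  case False
  define m where "m = n - 2"
  have nm: "n = m + 2" using False n by (simp add: m_def)
  obtain p q where pq: "p 0 = 1" "p 1 = 0" "q 0 = 0" "q 1 = 1"
    "\<forall>t\<in>I. (\<Sum>i<n. p i * v i t) \<noteq> 0 \<or> (\<Sum>i<n. q i * v i t) \<noteq> 0"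
    using plane_projection_nonvanishing[OF I k] v unfolding nm by blast
  define w where "w = (\<lambda>t. \<Sum>i<n. p i * v i t)"
  define z where "z = (\<lambda>t. \<Sum>i<n. q i * v i t)"
  define s where "s = (\<lambda>t. w t * w t + z t * z t)"
  have s0: "\<forall>t\<in>I. s t \<noteq> 0"
    using pq(5) by (simp add: s_def w_def z_def sum_squares_eq_zero_iff)
  have [simp]: "Ck_on k I w" "Ck_on k I z" "Ck_on k I s"
    unfolding s_def w_def z_def using v(1) by (auto intro!: Ck_on_sum Ck_on_add Ck_on_mult Ck_on_const I)
  \<comment> \<open>\<open>f\<close> and \<open>g\<close> rotate and scale the projected plane so that the image \<open>(w, z)\<close> of \<open>v\<close> becomes \<open>(1, 0)\<close>.\<close>
  define f where "f = (\<lambda>j t. (w t * p j + z t * q j) * inverse (s t))"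
  define g where "g = (\<lambda>j t. w t * q j - z t * p j)"
  \<comment> \<open>The rows from 2 on are the functionals x_i - v_i f(x). They annihilate
    \<open>v\<close> because f(v) = 1, and on a kernel vector, where f(x) = 0, they return x_i. A
    kernel vector thus lies in the first two coordinates, where \<open>f\<close> and
    \<open>g\<close> form an invertible system with determinant 1 up to the scaling by
    \<open>s\<close>.\<close>
  define A where "A = (\<lambda>t. mat n n (\<lambda>(i, j). if i = 0 then f j t else if i = 1 then g j t
     else (if i = j then 1 else 0) - v i t * f j t))"
  have Ckf: "Ck_on k I (f j)" and Ckg: "Ck_on k I (g j)" for j
    unfolding f_def g_def using s0
    by (auto intro!: Ck_on_diff Ck_on_add Ck_on_mult Ck_on_const Ck_on_inverse I)
  have "Ck_mat_fun k I n n A"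
  proof (rule Ck_mat_funI)
    show "Ck_on k I (\<lambda>t. A t $$ (i, j))" if "i < n" "j < n" for i j
    proof -
      have "Ck_on k I (\<lambda>t. (if i = j then 1 else 0) - v i t * f j t)"
        using v(1) that by (intro Ck_on_diff Ck_on_mult Ck_on_const Ckf I) auto
      then show ?thesis
        using that Ckf[of j] Ckg[of j] by (cases "i = 0"; cases "i = 1") (simp_all add: A_def)
    qed
  qed (simp add: A_def)
  moreover have "det (A t) \<noteq> 0" and "\<forall>i<n. (\<Sum>j<n. A t $$ (i, j) * v j t) = (if i = 0 then 1 else 0)"
    if t: "t \<in> I" for t
  proof -
    have comb: "(\<Sum>j<n. f j t * x j) = (w t * (\<Sum>j<n. p j * x j) + z t * (\<Sum>j<n. q j * x j)) * inverse (s t)"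
      "(\<Sum>j<n. g j t * x j) = w t * (\<Sum>j<n. q j * x j) - z t * (\<Sum>j<n. p j * x j)" for x
      unfolding f_def g_def
      by (simp_all add: sum_distrib_left sum_distrib_right sum.distrib sum_subtractf algebra_simps)
    have rows: "(\<Sum>j<n. A t $$ (i, j) * x j) = (if i = 0 then (\<Sum>j<n. f j t * x j)
       else if i = 1 then (\<Sum>j<n. g j t * x j) else x i - v i t * (\<Sum>j<n. f j t * x j))"
      if "i < n" for i x
    proof -
      have "(\<Sum>j<n. ((if i = j then 1 else 0) - v i t * f j t) * x j)
          = (\<Sum>j<n. if i = j then x j else 0) - v i t * (\<Sum>j<n. f j t * x j)"
        unfolding sum_distrib_left sum_subtractf[symmetric] by (rule sum.cong) (auto simp: algebra_simps)
      then show ?thesis using that by (simp add: A_def)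
    qed
    have "(\<Sum>j<n. f j t * v j t) = 1" "(\<Sum>j<n. g j t * v j t) = 0"
      unfolding comb using s0 t fun_cong[OF w_def, of t, symmetric] fun_cong[OF z_def, of t, symmetric]
        fun_cong[OF s_def, of t, symmetric] by simp_all
    then show "\<forall>i<n. (\<Sum>j<n. A t $$ (i, j) * v j t) = (if i = 0 then 1 else 0)"
      by (simp add: rows)
    show "det (A t) \<noteq> 0"
    proof (rule det_nonzeroI)
      show cA: "A t \<in> carrier_mat n n" by (simp add: A_def)
      fix x :: "real vec" assume x: "x \<in> carrier_vec n" "A t *\<^sub>v x = 0\<^sub>v n"
      let ?x = "vec_index x"
      have r: "(\<Sum>j<n. A t $$ (i, j) * ?x j) = 0" if "i < n" for i
        using index_mult_mat_vec_sum[OF cA x(1) that] x(2) that by simp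
      have F: "(\<Sum>j<n. f j t * ?x j) = 0" using r[of 0] rows[of 0 ?x] nm by simp
      have G: "(\<Sum>j<n. g j t * ?x j) = 0" using r[of 1] rows[of 1 ?x] nm by simp
      have x0: "?x i = 0" if "i < n" "2 \<le> i" for i
        using r[of i] rows[of i ?x] F that by simp
      have 2: "(\<Sum>i<n. c i * ?x i) = c 0 * ?x 0 + c 1 * ?x 1" for c :: "nat \<Rightarrow> real"
        using sum_lessThan_split[of "\<lambda>i. c i * ?x i" 2 m] x0
        by (simp add: numeral_2_eq_2 add.commute nm)
      have "w t * ?x 0 + z t * ?x 1 = 0" "w t * ?x 1 - z t * ?x 0 = 0"
        using F G s0 t unfolding comb 2 by (simp_all add: pq(1-4)[unfolded One_nat_def])
      moreover have "s t * ?x 0 = w t * (w t * ?x 0 + z t * ?x 1) - z t * (w t * ?x 1 - z t * ?x 0)"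
        "s t * ?x 1 = z t * (w t * ?x 0 + z t * ?x 1) + w t * (w t * ?x 1 - z t * ?x 0)"
        by (simp_all add: s_def algebra_simps)
      ultimately have "s t * ?x 0 = 0" "s t * ?x 1 = 0" by simp_all
      then have "?x 0 = 0" "?x 1 = 0" using s0 t by auto
      then have "?x i = 0" if "i < n" for i
        using x0[of i] that by (cases "i = 0"; cases "i = 1") auto
      then show "x = 0\<^sub>v n" using vec_eq_0_iff_index[OF x(1)] by simp
    qed
  qed
  ultimately show ?thesis by blast
qed

text \<open>Gaussian elimination with a smooth global step in place of a pivot: no single entry need
  stay nonzero on \<open>I\<close>, but the part of column \<open>j\<close> from row
  \<open>j\<close> on never vanishes as a vector, and that part is moved to a unit vector. The bound
  \<open>j \<le> n\<close> is carried along because it says that there are still rows to work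
  on.\<close>

lemma columns_to_unit_vectors:
  fixes N :: mat_fun
  assumes I: "perfect I" "I \<noteq> {}" and k: "1 \<le> k" and N: "Ck_mat_fun k I n m N"
    and inj: "\<forall>t\<in>I. \<forall>x\<in>carrier_vec m. N t *\<^sub>v x = 0\<^sub>v n \<longrightarrow> x = 0\<^sub>v m"
    and "j \<le> m"
  shows "j \<le> n \<and> (\<exists>A. Ck_mat_fun k I n n A \<and> (\<forall>t\<in>I. det (A t) \<noteq> 0 \<and>
    (\<forall>i<n. \<forall>c<j. (A t * N t) $$ (i, c) = (if i = c then 1 else 0))))"
  using assms(6)
proof (induction j)
  case 0
  then show ?case
    by (auto intro!: exI[of _ "\<lambda>_. 1\<^sub>m n"] Ck_mat_fun_const I)
next
  case (Suc j)
  then obtain A where jn: "j \<le> n" and A: "Ck_mat_fun k I n n A" "\<forall>t\<in>I. det (A t) \<noteq> 0"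
    and red: "\<And>t i c. t \<in> I \<Longrightarrow> i < n \<Longrightarrow> c < j \<Longrightarrow> (A t * N t) $$ (i, c) = (if i = c then 1 else 0)"
    by auto
  note cA = Ck_mat_funD(1)[OF A(1)] and cN = Ck_mat_funD(1)[OF N]
  define M where "M = (\<lambda>t. A t * N t)"
  have M: "Ck_mat_fun k I n m M" unfolding M_def by (rule Ck_mat_fun_mult[OF I(1) A(1) N])
  note cM = Ck_mat_funD(1)[OF M]
  obtain B where B: "Ck_mat_fun k I n n B" "\<And>t. t \<in> I \<Longrightarrow> A t * B t = 1\<^sub>m n"
      "\<And>t. t \<in> I \<Longrightarrow> B t * A t = 1\<^sub>m n"
    using Ck_mat_fun_inverse_exists[OF I(1) A] by metis
  have jm: "j < m" using Suc.prems by simp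
  have nonvan: "\<exists>i<n. j \<le> i \<and> M t $$ (i, j) \<noteq> 0" if t: "t \<in> I" for t
  proof (rule ccontr)
    assume *: "\<not> ?thesis"
    \<comment> \<open>If column \<open>j\<close> vanished from row \<open>j\<close> on, it would be
      a combination of the earlier columns, which are unit vectors; \<open>x\<close> is this
      relation, and its entry -1 contradicts injectivity.\<close>
    define x where "x = vec m (\<lambda>c. if c < j then M t $$ (c, j) else if c = j then -1 else 0)"
    have cx: "x \<in> carrier_vec m" by (simp add: x_def)
    have "vec_index (M t *\<^sub>v x) i = 0" if i: "i < n" for i
    proof -
      have "(\<Sum>c<m. M t $$ (i, c) * vec_index x c) =
          (\<Sum>c<m. (if c = i \<and> i < j then M t $$ (i, j) else 0) + (if c = j then - M t $$ (i, j) else 0))"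
        using red[OF t i] by (intro sum.cong) (auto simp: x_def M_def)
      also have "\<dots> = (\<Sum>c<m. if c = i then (if i < j then M t $$ (i, j) else 0) else 0) - M t $$ (i, j)"
        using jm by (simp add: sum.distrib)
      also have "\<dots> = (if i < j then M t $$ (i, j) else 0) - M t $$ (i, j)" using jm by simp
      also have "\<dots> = 0" using * i by auto
      finally show ?thesis using index_mult_mat_vec_sum[OF cM[OF t] cx i] by simp
    qed
    then have "M t *\<^sub>v x = 0\<^sub>v n" using cM[OF t] by (intro eq_vecI) auto
    then have "A t *\<^sub>v (N t *\<^sub>v x) = 0\<^sub>v n"
      using assoc_mult_mat_vec[OF cA[OF t] cN[OF t] cx] by (simp add: M_def)
    then have "N t *\<^sub>v x = 0\<^sub>v n"
      using mult_left_inverse_vec_eq_0[OF cA[OF t] Ck_mat_funD(1)[OF B(1) t] B(3)[OF t]]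
        mult_mat_vec_carrier[OF cN[OF t] cx] by blast
    then have "x = 0\<^sub>v m" using inj t cx by simp
    then have "vec_index x j = 0" using jm by simp
    then show False using jm by (simp add: x_def)
  qed
  have jn': "j < n" using nonvan I(2) by (meson ex_in_conv le_less_trans)
  define l where "l = n - j"
  have nl: "n = j + l" and l: "0 < l" using jn' by (simp_all add: l_def)
  have "\<forall>i<l. Ck_on k I (\<lambda>t. M t $$ (j + i, j))"
    using jm nl by (auto intro: Ck_mat_funD(2)[OF M])
  moreover have "\<exists>i<l. M t $$ (j + i, j) \<noteq> 0" if t: "t \<in> I" for t
    using nonvan[OF t] nl by (metis le_add_diff_inverse nat_add_left_cancel_less)
  ultimately obtain G where G: "Ck_mat_fun k I l l G" "\<forall>t\<in>I. det (G t) \<noteq> 0"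
    and Gv: "\<And>t i. t \<in> I \<Longrightarrow> i < l \<Longrightarrow> (\<Sum>c<l. G t $$ (i, c) * M t $$ (j + c, j)) = (if i = 0 then 1 else 0)"
    using column_to_unit_vector[OF I(1) k l, of "\<lambda>i t. M t $$ (j + i, j)"] by blast
  note cG = Ck_mat_funD(1)[OF G(1)]
  \<comment> \<open>Row 0 of \<open>G\<close> takes the value 1 on the lower part of column
    \<open>j\<close>, so subtracting \<open>M t $$ (i, j)\<close> times that row clears the entry
    above. The earlier columns have zero lower part and are left alone by both \<open>U\<close> and
    \<open>G\<close>.\<close>
  define U where "U = (\<lambda>t. mat j l (\<lambda>(i, c). - M t $$ (i, j) * G t $$ (0, c)))"
  have U: "Ck_mat_fun k I j l U"
  proof (rule Ck_mat_funI)
    show "Ck_on k I (\<lambda>t. U t $$ (i, c))" if "i < j" "c < l" for i c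
      unfolding U_def using that jm jn' l
      by (auto intro!: Ck_on_mult Ck_on_uminus Ck_mat_funD(2)[OF M] Ck_mat_funD(2)[OF G(1)] I)
  qed (simp add: U_def)
  define T where "T = four_block_fun (\<lambda>_. 1\<^sub>m j) U (\<lambda>_. 0\<^sub>m l j) G"
  have T: "Ck_mat_fun k I n n T"
    unfolding T_def nl by (intro Ck_mat_fun_four_block Ck_mat_fun_const U G I) auto
  note cT = Ck_mat_funD(1)[OF T]
  have TA: "Ck_mat_fun k I n n (\<lambda>t. T t * A t)" by (rule Ck_mat_fun_mult[OF I(1) T A(1)])
  have dT: "det (T t) \<noteq> 0" if t: "t \<in> I" for t
    unfolding T_def four_block_fun_def
    using det_four_block_mat_lower_left_zero[OF one_carrier_mat _ refl cG[OF t], of "U t"] G(2) t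
    by (simp add: U_def)
  have "det (T t * A t) \<noteq> 0" if t: "t \<in> I" for t
    using det_mult[OF cT[OF t] cA[OF t]] dT[OF t] A(2) t by simp
  moreover have "(T t * A t * N t) $$ (i, c) = (if i = c then 1 else 0)"
    if t: "t \<in> I" and i: "i < n" and c: "c < Suc j" for t i c
  proof -
    have cm: "c < m" using c jm by simp
    have Ti: "T t $$ (i, x) = (if i < j then if x < j then 1\<^sub>m j $$ (i, x) else U t $$ (i, x - j)
       else if x < j then 0 else G t $$ (i - j, x - j))" if "x < n" for x
      unfolding T_def using index_four_block_fun[of "\<lambda>_. 1\<^sub>m j" t j j U l "\<lambda>_. 0\<^sub>m l j" l G i x]
        cG[OF t] i that nl by (auto simp: U_def)
    have Mlow: "M t $$ (j + x, c) = 0" if "c \<noteq> j" "x < l" for x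
      using red[of t "j + x" c] t c that nl by (simp add: M_def)
    have Mup: "M t $$ (x, c) = (if x = c then 1 else 0)" if "c \<noteq> j" "x < n" for x
      using red[of t x c] t c that by (simp add: M_def)
    have "(T t * A t * N t) $$ (i, c) = (T t * M t) $$ (i, c)"
      using assoc_mult_mat[OF cT[OF t] cA[OF t] cN[OF t]] by (simp add: M_def)
    also have "\<dots> = (\<Sum>x<j. T t $$ (i, x) * M t $$ (x, c)) + (\<Sum>x<l. T t $$ (i, j + x) * M t $$ (j + x, c))"
      using index_mult_mat_sum[OF cT[OF t] cM[OF t] i cm] sum_lessThan_split[of _ j l] nl by simp
    also have "\<dots> = (if i = c then 1 else 0)"
    proof (cases "i < j")
      case True
      have "(\<Sum>x<j. T t $$ (i, x) * M t $$ (x, c)) = (\<Sum>x<j. if i = x then M t $$ (x, c) else 0)"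
        using True nl by (intro sum.cong) (auto simp: Ti)
      also have "\<dots> = M t $$ (i, c)" using True by simp
      finally have 1: "(\<Sum>x<j. T t $$ (i, x) * M t $$ (x, c)) = M t $$ (i, c)" .
      have 2: "(\<Sum>x<l. T t $$ (i, j + x) * M t $$ (j + x, c)) =
          - M t $$ (i, j) * (\<Sum>x<l. G t $$ (0, x) * M t $$ (j + x, c))"
        unfolding sum_distrib_left using True nl by (intro sum.cong) (auto simp: Ti U_def)
      show ?thesis
      proof (cases "c = j")
        case True
        then show ?thesis unfolding 1 2 using Gv[OF t l] \<open>i < j\<close> by simp
      next
        case False
        then show ?thesis unfolding 1 2 using Mlow Mup i by simp
      qed
    next
      case False
      have 1: "(\<Sum>x<j. T t $$ (i, x) * M t $$ (x, c)) = 0"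
        using False nl by (intro sum.neutral) (auto simp: Ti)
      have 2: "(\<Sum>x<l. T t $$ (i, j + x) * M t $$ (j + x, c)) = (\<Sum>x<l. G t $$ (i - j, x) * M t $$ (j + x, c))"
        using False nl by (intro sum.cong) (auto simp: Ti)
      show ?thesis
      proof (cases "c = j")
        case True
        then show ?thesis unfolding 1 2 using Gv[OF t, of "i - j"] False i nl by auto
      next
        case c': False
        then show ?thesis unfolding 1 2 using Mlow False c by simp
      qed
    qed
    finally show ?thesis .
  qed
  ultimately show ?case using TA jn' by (intro conjI exI[of _ "\<lambda>t. T t * A t"]) auto
qed

text \<open>If \<open>A\<close> turns \<open>N\<close> into the first unit vectors, then the inverse
  of \<open>A\<close> maps these back, that is, its first \<open>m\<close> columns are those of
  \<open>N\<close>.\<close>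

lemma smooth_basis_completion:
  fixes N :: mat_fun
  assumes I: "perfect I" "I \<noteq> {}" and k: "1 \<le> k" and N: "Ck_mat_fun k I n m N"
    and inj: "\<forall>t\<in>I. \<forall>x\<in>carrier_vec m. N t *\<^sub>v x = 0\<^sub>v n \<longrightarrow> x = 0\<^sub>v m"
  shows "\<exists>C. Ck_mat_fun k I n n C \<and>
    (\<forall>t\<in>I. det (C t) \<noteq> 0 \<and> (\<forall>i<n. \<forall>j<m. C t $$ (i, j) = N t $$ (i, j)))"
proof -
  obtain A where mn: "m \<le> n" and A: "Ck_mat_fun k I n n A" "\<forall>t\<in>I. det (A t) \<noteq> 0"
    and red: "\<And>t i c. t \<in> I \<Longrightarrow> i < n \<Longrightarrow> c < m \<Longrightarrow> (A t * N t) $$ (i, c) = (if i = c then 1 else 0)"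
    using columns_to_unit_vectors[OF I k N inj order.refl] by blast
  obtain C where C: "Ck_mat_fun k I n n C" "\<And>t. t \<in> I \<Longrightarrow> A t * C t = 1\<^sub>m n"
      "\<And>t. t \<in> I \<Longrightarrow> C t * A t = 1\<^sub>m n"
    using Ck_mat_fun_inverse_exists[OF I(1) A] by metis
  note c = Ck_mat_funD(1)[OF A(1)] Ck_mat_funD(1)[OF C(1)] Ck_mat_funD(1)[OF N]
  show ?thesis
  proof (intro exI[of _ C] conjI ballI allI impI)
    show "det (C t) \<noteq> 0" if "t \<in> I" for t
      using det_mult[OF c(1,2)[OF that]] C(2)[OF that] by auto
    show "C t $$ (i, j) = N t $$ (i, j)" if t: "t \<in> I" and ij: "i < n" "j < m" for t i j
    proof -
      have "N t = C t * (A t * N t)"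
        using assoc_mult_mat[OF c(2,1,3)[OF t]] C(3)[OF t] c(3)[OF t] by simp
      then have "N t $$ (i, j) = (C t * (A t * N t)) $$ (i, j)" by simp
      also have "\<dots> = (\<Sum>l<n. C t $$ (i, l) * (A t * N t) $$ (l, j))"
        using c[OF t] ij by (intro index_mult_mat_sum) auto
      also have "\<dots> = (\<Sum>l<n. if l = j then C t $$ (i, j) else 0)"
        using red[OF t _ ij(2)] by (intro sum.cong) auto
      also have "\<dots> = C t $$ (i, j)" using ij mn by simp
      finally show ?thesis ..
    qed
  qed (rule C)
qed

section \<open>Block indices\<close>

definition blk :: "nat list \<Rightarrow> nat \<Rightarrow> nat" where
  "blk ls p = (LEAST i. p < offset ls (Suc i))"

text \<open>
  \<open>suc_pos\<close> moves a row or column index to the same place of the next block, which \<open>has_suc\<close> asserts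
  to exist; \<open>pre_pos\<close> is its inverse. Thus \<open>N_Ec\<close> is the matrix of the partial injection \<open>suc_pos\<close>.
\<close>

definition has_suc :: "nat list \<Rightarrow> nat \<Rightarrow> bool" where
  "has_suc ls p \<longleftrightarrow> Suc (blk ls p) < length ls \<and> p - offset ls (blk ls p) < ls ! Suc (blk ls p)"

definition suc_pos :: "nat list \<Rightarrow> nat \<Rightarrow> nat" where
  "suc_pos ls p = offset ls (Suc (blk ls p)) + (p - offset ls (blk ls p))"

definition pre_pos :: "nat list \<Rightarrow> nat \<Rightarrow> nat" where
  "pre_pos ls q = offset ls (blk ls q - 1) + (q - offset ls (blk ls q))"

lemma blk_bounds:
  assumes "p < sum_list ls"
  shows "blk ls p < length ls" "offset ls (blk ls p) \<le> p" "p < offset ls (blk ls p) + ls ! blk ls p"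
proof -
  have ne: "ls \<noteq> []" using assms by auto
  have "p < offset ls (Suc (length ls - 1))" using assms ne by (simp add: offset_def)
  then have L: "p < offset ls (Suc (blk ls p))" and "blk ls p \<le> length ls - 1"
    unfolding blk_def by (rule LeastI, rule Least_le)
  then show l: "blk ls p < length ls" using ne by (cases ls) auto
  show "p < offset ls (blk ls p) + ls ! blk ls p" using L offset_Suc[OF l] by simp
  show "offset ls (blk ls p) \<le> p"
  proof (cases "blk ls p")
    case 0
    then show ?thesis by (simp add: offset_def)
  next
    case (Suc j)
    then have "\<not> p < offset ls (Suc j)"
      using not_less_Least[of j "\<lambda>i. p < offset ls (Suc i)"] by (simp add: blk_def)
    then show ?thesis using Suc by simp
  qed
qed

lemma blk_offset_add:
  assumes "i < length ls" "r < ls ! i"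
  shows "blk ls (offset ls i + r) = i"
proof -
  let ?p = "offset ls i + r"
  note b = blk_bounds[OF offset_add_less[OF assms]]
  have "offset ls (blk ls ?p) + (?p - offset ls (blk ls ?p)) = offset ls i + r" using b(2) by simp
  moreover have "?p - offset ls (blk ls ?p) < ls ! blk ls ?p" using b(2,3) by linarith
  ultimately show ?thesis using offset_add_eq_iff[OF b(1) assms(1) _ assms(2)] by blast
qed

lemma block_eq_0_iff:
  "block ls i j A = 0\<^sub>m (ls ! i) (ls ! j) \<longleftrightarrow>
    (\<forall>r<ls ! i. \<forall>c<ls ! j. A $$ (offset ls i + r, offset ls j + c) = 0)"
proof
  assume "block ls i j A = 0\<^sub>m (ls ! i) (ls ! j)"
  then have "block ls i j A $$ (r, c) = 0" if "r < ls ! i" "c < ls ! j" for r c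
    using that by simp
  then show "\<forall>r<ls ! i. \<forall>c<ls ! j. A $$ (offset ls i + r, offset ls j + c) = 0"
    by (simp add: block_def)
qed (auto simp: block_def intro!: eq_matI)

text \<open>The relation \<open>P\<close> is kept general so that the strict and the nonstrict
  triangular shape become entrywise conditions by the same argument.\<close>

lemma blocks_eq_0_iff:
  "(\<forall>i<length ls. \<forall>j<length ls. P i j \<longrightarrow> block ls i j A = 0\<^sub>m (ls ! i) (ls ! j)) \<longleftrightarrow>
    (\<forall>p<sum_list ls. \<forall>q<sum_list ls. P (blk ls p) (blk ls q) \<longrightarrow> A $$ (p, q) = 0)"
    (is "?L \<longleftrightarrow> ?R")
proof
  assume L: ?L
  show ?R
  proof (intro allI impI)
    fix p q assume pq: "p < sum_list ls" "q < sum_list ls" "P (blk ls p) (blk ls q)"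
    note b = blk_bounds[OF pq(1)] blk_bounds[OF pq(2)]
    have "\<forall>r<ls ! blk ls p. \<forall>c<ls ! blk ls q.
        A $$ (offset ls (blk ls p) + r, offset ls (blk ls q) + c) = 0"
      using L pq b by (simp flip: block_eq_0_iff)
    moreover have "p - offset ls (blk ls p) < ls ! blk ls p" "q - offset ls (blk ls q) < ls ! blk ls q"
      using b by linarith+
    ultimately have "A $$ (offset ls (blk ls p) + (p - offset ls (blk ls p)),
        offset ls (blk ls q) + (q - offset ls (blk ls q))) = 0" by blast
    then show "A $$ (p, q) = 0" using b by simp
  qed
next
  assume ?R
  then show ?L
    by (auto simp: block_eq_0_iff offset_add_less blk_offset_add)
qed

lemma BUT_iff:
  "A \<in> BUT I ls \<longleftrightarrow> mat_fun_on I (sum_list ls) (sum_list ls) A \<and>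
    (\<forall>t\<in>I. \<forall>p<sum_list ls. \<forall>q<sum_list ls. blk ls q < blk ls p \<longrightarrow> A t $$ (p, q) = 0)"
  using blocks_eq_0_iff[of ls "\<lambda>i j. j < i"] by (auto simp: BUT_def)

lemma SUT_iff:
  "A \<in> SUT I ls \<longleftrightarrow> mat_fun_on I (sum_list ls) (sum_list ls) A \<and>
    (\<forall>t\<in>I. \<forall>p<sum_list ls. \<forall>q<sum_list ls. blk ls q \<le> blk ls p \<longrightarrow> A t $$ (p, q) = 0)"
  using blocks_eq_0_iff[of ls "\<lambda>i j. j \<le> i"] by (auto simp: SUT_def)

lemma block_sizes_Suc_le: "block_sizes ls \<Longrightarrow> Suc i < length ls \<Longrightarrow> ls ! Suc i \<le> ls ! i"
  by (auto simp: block_sizes_def sorted_wrt_iff_nth_less)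

lemma suc_pos:
  assumes "p < sum_list ls" "has_suc ls p"
  shows "suc_pos ls p < sum_list ls" "blk ls (suc_pos ls p) = Suc (blk ls p)"
    "pre_pos ls (suc_pos ls p) = p"
proof -
  note b = blk_bounds[OF assms(1)]
  show "suc_pos ls p < sum_list ls" "blk ls (suc_pos ls p) = Suc (blk ls p)"
    using assms(2) by (simp_all add: has_suc_def suc_pos_def offset_add_less blk_offset_add)
  then show "pre_pos ls (suc_pos ls p) = p" using b by (simp add: pre_pos_def) (simp add: suc_pos_def)
qed

lemma pre_pos:
  assumes "block_sizes ls" "q < sum_list ls" "blk ls q \<noteq> 0"
  shows "pre_pos ls q < sum_list ls" "Suc (blk ls (pre_pos ls q)) = blk ls q"
    "has_suc ls (pre_pos ls q)" "suc_pos ls (pre_pos ls q) = q"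
proof -
  note b = blk_bounds[OF assms(2)]
  obtain i where i: "blk ls q = Suc i" using assms(3) by (cases "blk ls q") auto
  have r: "q - offset ls (Suc i) < ls ! Suc i" using b i by simp
  then have r': "q - offset ls (Suc i) < ls ! i"
    using block_sizes_Suc_le[OF assms(1), of i] b(1) i by simp
  have il: "i < length ls" using b(1) i by simp
  have P: "pre_pos ls q = offset ls i + (q - offset ls (Suc i))" using i by (simp add: pre_pos_def)
  show "pre_pos ls q < sum_list ls" and B: "Suc (blk ls (pre_pos ls q)) = blk ls q"
    unfolding P i using offset_add_less[OF il r'] blk_offset_add[OF il r'] by simp_all
  have D: "pre_pos ls q - offset ls i = q - offset ls (Suc i)" using i by (simp add: pre_pos_def)
  show "has_suc ls (pre_pos ls q)" using B D i r b(1) by (simp add: has_suc_def)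
  show "suc_pos ls (pre_pos ls q) = q" using B D i b by (simp add: suc_pos_def)
qed

text \<open>Because block sizes do not increase, every index outside the first block has a
  predecessor, so \<open>suc_pos\<close> is a bijection from the indices with a successor onto those
  outside block 0.\<close>

lemma sum_suc_pos:
  fixes f :: "nat \<Rightarrow> nat \<Rightarrow> real"
  assumes "block_sizes ls"
  shows "(\<Sum>q<sum_list ls. if has_suc ls q then f q (suc_pos ls q) else 0) =
    (\<Sum>q<sum_list ls. if blk ls q = 0 then 0 else f (pre_pos ls q) q)"
proof -
  have "(\<Sum>q<sum_list ls. if has_suc ls q then f q (suc_pos ls q) else 0) =
      (\<Sum>q | q < sum_list ls \<and> has_suc ls q. f q (suc_pos ls q))"
    by (subst sum.inter_filter[symmetric]) (auto intro!: sum.cong)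
  also have "\<dots> = (\<Sum>q | q < sum_list ls \<and> blk ls q \<noteq> 0. f (pre_pos ls q) q)"
    by (rule sum.reindex_bij_witness[where i = "pre_pos ls" and j = "suc_pos ls"])
      (use suc_pos pre_pos[OF assms] in auto)
  also have "\<dots> = (\<Sum>q<sum_list ls. if blk ls q \<noteq> 0 then f (pre_pos ls q) q else 0)"
    by (subst sum.inter_filter[symmetric]) (auto intro!: sum.cong)
  also have "\<dots> = (\<Sum>q<sum_list ls. if blk ls q = 0 then 0 else f (pre_pos ls q) q)"
    by (intro sum.cong) auto
  finally show ?thesis .
qed

section \<open>\<open>N_Ec ls\<close> as a shift of indices\<close>

lemma N_Ec_carrier: "N_Ec ls \<in> carrier_mat (sum_list ls) (sum_list ls)"
  by (simp add: N_Ec_def)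

lemma index_N_Ec:
  assumes "block_sizes ls" "p < sum_list ls" "q < sum_list ls"
  shows "N_Ec ls $$ (p, q) = (if has_suc ls p \<and> q = suc_pos ls p then 1 else 0)"
proof -
  have "(\<exists>i r. Suc i < length ls \<and> r < ls ! Suc i \<and> p = offset ls i + r \<and> q = offset ls (Suc i) + r)
      \<longleftrightarrow> has_suc ls p \<and> q = suc_pos ls p" (is "?L \<longleftrightarrow> ?R")
  proof
    assume ?L
    then obtain i r where ir: "Suc i < length ls" "r < ls ! Suc i" "p = offset ls i + r"
      "q = offset ls (Suc i) + r" by blast
    then have "blk ls p = i" using block_sizes_Suc_le[OF assms(1) ir(1)] by (simp add: blk_offset_add)
    then show ?R using ir by (simp add: has_suc_def suc_pos_def)
  next
    assume ?R
    then show ?L using blk_bounds[OF assms(2)]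
      by (intro exI[of _ "blk ls p"] exI[of _ "p - offset ls (blk ls p)"])
        (simp add: has_suc_def suc_pos_def)
  qed
  then show ?thesis using assms by (simp add: N_Ec_def)
qed

lemma index_mult_N_Ec:
  assumes "block_sizes ls" "A \<in> carrier_mat n (sum_list ls)" "i < n" "q < sum_list ls"
  shows "(A * N_Ec ls) $$ (i, q) = (if blk ls q = 0 then 0 else A $$ (i, pre_pos ls q))"
proof -
  have "(A * N_Ec ls) $$ (i, q) = (\<Sum>p<sum_list ls. A $$ (i, p) * N_Ec ls $$ (p, q))"
    using index_mult_mat_sum[OF assms(2) N_Ec_carrier assms(3,4)] .
  also have "\<dots> = (\<Sum>p<sum_list ls. if has_suc ls p then (if q = suc_pos ls p then A $$ (i, p) else 0) else 0)"
    using index_N_Ec[OF assms(1) _ assms(4)] by (intro sum.cong) auto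
  also have "\<dots> = (\<Sum>p<sum_list ls. if blk ls p = 0 then 0 else (if q = p then A $$ (i, pre_pos ls p) else 0))"
    by (rule sum_suc_pos[OF assms(1), of "\<lambda>p p'. if q = p' then A $$ (i, p) else 0"])
  also have "\<dots> = (\<Sum>p<sum_list ls. if q = p then (if blk ls p = 0 then 0 else A $$ (i, pre_pos ls p)) else 0)"
    by (intro sum.cong) auto
  also have "\<dots> = (if blk ls q = 0 then 0 else A $$ (i, pre_pos ls q))" using assms(4) by simp
  finally show ?thesis .
qed

lemma sum_over_block:
  fixes f :: "nat \<Rightarrow> real"
  assumes "i < length ls" "\<And>q. q < sum_list ls \<Longrightarrow> blk ls q \<noteq> i \<Longrightarrow> f q = 0"
  shows "(\<Sum>q<sum_list ls. f q) = (\<Sum>c<ls ! i. f (offset ls i + c))"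
proof -
  have "(\<Sum>q<sum_list ls. f q) = (\<Sum>q\<in>(+) (offset ls i) ` {..<ls ! i}. f q)"
  proof (rule sum.mono_neutral_right)
    show "\<forall>q\<in>{..<sum_list ls} - (+) (offset ls i) ` {..<ls ! i}. f q = 0"
    proof
      fix q assume q: "q \<in> {..<sum_list ls} - (+) (offset ls i) ` {..<ls ! i}"
      have "blk ls q \<noteq> i"
      proof
        assume "blk ls q = i"
        then have "q = offset ls i + (q - offset ls i)" "q - offset ls i < ls ! i"
          using blk_bounds[of q ls] q by auto
        then show False using q by blast
      qed
      then show "f q = 0" using assms(2) q by simp
    qed
  qed (use offset_add_less[OF assms(1)] in auto)
  also have "\<dots> = (\<Sum>c<ls ! i. f (offset ls i + c))" by (subst sum.reindex) auto
  finally show ?thesis .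
qed

section \<open>Matrices with injective diagonal blocks\<close>

definition low :: "nat list \<Rightarrow> nat \<Rightarrow> real vec \<Rightarrow> bool" where
  "low ls i x \<longleftrightarrow> (\<forall>q<sum_list ls. i \<le> blk ls q \<longrightarrow> vec_index x q = 0)"

text \<open>
  For block upper triangular \<open>A\<close> the following says that the diagonal blocks of \<open>A\<close> are injective;
  the vectors with \<open>low ls i\<close> are those supported in the first \<open>i\<close> blocks.
\<close>

definition graded_inj :: "nat list \<Rightarrow> real mat \<Rightarrow> bool" where
  "graded_inj ls A \<longleftrightarrow> (\<forall>i<length ls. \<forall>x\<in>carrier_vec (sum_list ls).
     low ls (Suc i) x \<longrightarrow> low ls i (A *\<^sub>v x) \<longrightarrow> low ls i x)"

lemma low_length: "length ls \<le> i \<Longrightarrow> low ls i x"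
  by (auto simp: low_def dest: blk_bounds(1))

lemma low_mono: "low ls i x \<Longrightarrow> i \<le> j \<Longrightarrow> low ls j x"
  by (auto simp: low_def)

text \<open>Every vector is supported in all \<open>length ls\<close> blocks; from there the support
  is cut down by one block at a time until block \<open>i\<close> is reached.\<close>

lemma graded_inj_low:
  assumes "graded_inj ls A" "x \<in> carrier_vec (sum_list ls)" "low ls i (A *\<^sub>v x)"
  shows "low ls i x"
proof (cases "i \<le> length ls")
  case True
  then show ?thesis
  proof (induction rule: inc_induct)
    case base
    then show ?case by (simp add: low_length)
  next
    case (step j)
    then show ?case using assms low_mono[OF assms(3), of j] by (auto simp: graded_inj_def)
  qed
next
  case False
  then show ?thesis by (simp add: low_length)
qed

lemma graded_inj_det:
  assumes "graded_inj ls A" "A \<in> carrier_mat (sum_list ls) (sum_list ls)"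
  shows "det A \<noteq> 0"
proof (rule det_nonzeroI[OF assms(2)])
  fix x assume x: "x \<in> carrier_vec (sum_list ls)" "A *\<^sub>v x = 0\<^sub>v (sum_list ls)"
  then have "low ls 0 (A *\<^sub>v x)" by (simp add: low_def)
  from graded_inj_low[OF assms(1) x(1) this] show "x = 0\<^sub>v (sum_list ls)"
    using vec_eq_0_iff_index[OF x(1)] by (simp add: low_def)
qed

text \<open>Column \<open>q\<close> of \<open>B\<close> solves A x = e_q. The right side lives in
  the blocks up to that of \<open>q\<close>, hence so does the solution.\<close>

lemma graded_inj_right_inverse_BUT:
  assumes A: "graded_inj ls A" "A \<in> carrier_mat (sum_list ls) (sum_list ls)"
    and B: "B \<in> carrier_mat (sum_list ls) (sum_list ls)" "A * B = 1\<^sub>m (sum_list ls)"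
    and pq: "p < sum_list ls" "q < sum_list ls" "blk ls q < blk ls p"
  shows "B $$ (p, q) = 0"
proof -
  let ?x = "col B q"
  have x: "?x \<in> carrier_vec (sum_list ls)" by (rule col_carrier_vec[OF pq(2) B(1)])
  have "A *\<^sub>v ?x = col (1\<^sub>m (sum_list ls)) q"
    using col_mult2[OF A(2) B(1) pq(2)] unfolding B(2) by (rule sym)
  then have "A *\<^sub>v ?x = unit_vec (sum_list ls) q" using pq(2) by simp
  then have "low ls (Suc (blk ls q)) (A *\<^sub>v ?x)"
    unfolding low_def using pq(2) by (metis Suc_n_not_le_n index_unit_vec(1))
  then have "low ls (Suc (blk ls q)) ?x" by (rule graded_inj_low[OF A(1) x])
  then show ?thesis
    using pq index_col[of p B q] carrier_matD[OF B(1)] by (simp add: low_def)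
qed

text \<open>For a vector supported in the blocks up to \<open>i\<close>, triangularity reduces block
  \<open>i\<close> of the product to \<open>C i\<close> applied to block \<open>i\<close> of the
  vector.\<close>

lemma graded_injI:
  assumes A: "A \<in> carrier_mat (sum_list ls) (sum_list ls)"
    and BUT: "\<And>p q. p < sum_list ls \<Longrightarrow> q < sum_list ls \<Longrightarrow> blk ls q < blk ls p \<Longrightarrow> A $$ (p, q) = 0"
    and C: "\<And>i. i < length ls \<Longrightarrow> C i \<in> carrier_mat (ls ! i) (ls ! i)"
      "\<And>i. i < length ls \<Longrightarrow> det (C i) \<noteq> 0"
    and diag: "\<And>i r c. i < length ls \<Longrightarrow> r < ls ! i \<Longrightarrow> c < ls ! i \<Longrightarrow>
        A $$ (offset ls i + r, offset ls i + c) = C i $$ (r, c)"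
  shows "graded_inj ls A"
  unfolding graded_inj_def
proof (intro allI impI ballI)
  fix i x assume i: "i < length ls" and x: "x \<in> carrier_vec (sum_list ls)" "low ls (Suc i) x"
    and Ax: "low ls i (A *\<^sub>v x)"
  define y where "y = vec (ls ! i) (\<lambda>c. vec_index x (offset ls i + c))"
  have cy: "y \<in> carrier_vec (ls ! i)" by (simp add: y_def)
  have "vec_index (C i *\<^sub>v y) r = 0" if r: "r < ls ! i" for r
  proof -
    let ?p = "offset ls i + r"
    have p: "?p < sum_list ls" "blk ls ?p = i" using i r by (simp_all add: offset_add_less blk_offset_add)
    have "A $$ (?p, q) * vec_index x q = 0" if "q < sum_list ls" "blk ls q \<noteq> i" for q
      using that p BUT[of ?p q] x(2) by (cases "blk ls q < i") (auto simp: low_def)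
    then have "(\<Sum>q<sum_list ls. A $$ (?p, q) * vec_index x q)
        = (\<Sum>c<ls ! i. A $$ (?p, offset ls i + c) * vec_index x (offset ls i + c))"
      by (rule sum_over_block[OF i])
    also have "\<dots> = (\<Sum>c<ls ! i. C i $$ (r, c) * vec_index y c)"
      using diag[OF i r] by (intro sum.cong) (auto simp: y_def)
    also have "\<dots> = vec_index (C i *\<^sub>v y) r" using index_mult_mat_vec_sum[OF C(1)[OF i] cy r] by simp
    finally show ?thesis
      using index_mult_mat_vec_sum[OF A x(1) p(1)] Ax p by (simp add: low_def)
  qed
  then have "C i *\<^sub>v y = 0\<^sub>v (ls ! i)" using C(1)[OF i] by (intro eq_vecI) auto
  then have "y = 0\<^sub>v (ls ! i)" using C[OF i] cy det_0_iff_vec_prod_zero[OF C(1)[OF i]] by blast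
  then have y0: "vec_index y c = 0" if "c < ls ! i" for c using that by simp
  show "low ls i x"
    unfolding low_def
  proof (intro allI impI)
    fix q assume q: "q < sum_list ls" "i \<le> blk ls q"
    show "vec_index x q = 0"
    proof (cases "blk ls q = i")
      case True
      then have "q = offset ls i + (q - offset ls i)" "q - offset ls i < ls ! i"
        using blk_bounds[OF q(1)] by auto
      then show ?thesis using y0[of "q - offset ls i"] by (simp add: y_def)
    next
      case False
      then show ?thesis using q x(2) by (simp add: low_def)
    qed
  qed
qed

text \<open>The property does not see entries strictly above the diagonal blocks: in the rows from
  block \<open>i\<close> on they only meet components in blocks beyond \<open>i\<close>, where the
  tested vector is zero.\<close>

lemma graded_inj_cong:
  assumes A: "A \<in> carrier_mat (sum_list ls) (sum_list ls)" "A' \<in> carrier_mat (sum_list ls) (sum_list ls)"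
    and "graded_inj ls A"
    and eq: "\<And>p q. p < sum_list ls \<Longrightarrow> q < sum_list ls \<Longrightarrow> blk ls q \<le> blk ls p \<Longrightarrow>
        A' $$ (p, q) = A $$ (p, q)"
  shows "graded_inj ls A'"
  unfolding graded_inj_def
proof (intro allI impI ballI)
  fix i x assume i: "i < length ls" and x: "x \<in> carrier_vec (sum_list ls)" "low ls (Suc i) x"
    and Ax: "low ls i (A' *\<^sub>v x)"
  have "vec_index (A *\<^sub>v x) p = vec_index (A' *\<^sub>v x) p" if p: "p < sum_list ls" "i \<le> blk ls p" for p
  proof -
    have "A $$ (p, q) * vec_index x q = A' $$ (p, q) * vec_index x q" if "q < sum_list ls" for q
      using eq[OF p(1) that] x(2) p that by (cases "blk ls q \<le> blk ls p") (auto simp: low_def)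
    then show ?thesis
      unfolding index_mult_mat_vec_sum[OF A(1) x(1) p(1)] index_mult_mat_vec_sum[OF A(2) x(1) p(1)]
      by (intro sum.cong) auto
  qed
  then have "low ls i (A *\<^sub>v x)" using Ax by (simp add: low_def)
  then show "low ls i x" using assms(3) i x by (auto simp: graded_inj_def)
qed

section \<open>Differential equations with a nilpotent coefficient\<close>

text \<open>The right side \<open>\<Phi>\<close> at level \<open>lev p\<close> reads
  \<open>z\<close> only at higher levels. The top level is correct after one application, and each
  further application settles the next level down, so \<mu> applications starting from zero reach a
  fixed point. Since each one differentiates once, iterate \<open>i\<close> is guaranteed k + \<mu>
  - i derivatives and the last one has k.\<close>

lemma nilpotent_differential_equation:
  fixes n A B B' :: "nat \<Rightarrow> nat \<Rightarrow> real \<Rightarrow> real" and lev :: "nat \<Rightarrow> nat"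
  assumes I: "perfect I"
    and lev: "\<And>p. p < a \<Longrightarrow> lev p < \<mu>"
    and nil: "\<And>p p' t. p < a \<Longrightarrow> p' < a \<Longrightarrow> t \<in> I \<Longrightarrow> lev p' \<le> lev p \<Longrightarrow> n p p' t = 0"
    and smooth: "\<And>p p'. p < a \<Longrightarrow> p' < a \<Longrightarrow> Ck_on (k + enat \<mu>) I (n p p')"
      "\<And>p q. p < a \<Longrightarrow> q < m \<Longrightarrow> Ck_on (k + enat \<mu>) I (A p q)"
      "\<And>q q'. q < m \<Longrightarrow> q' < m \<Longrightarrow> Ck_on (k + enat \<mu>) I (B q q')"
      "\<And>q q'. q < m \<Longrightarrow> q' < m \<Longrightarrow> Ck_on (k + enat \<mu>) I (B' q q')"
  shows "\<exists>z. (\<forall>p<a. \<forall>q<m. Ck_on k I (z p q)) \<and>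
    (\<forall>t\<in>I. \<forall>p<a. \<forall>q<m. z p q t = A p q t + (\<Sum>p'<a. n p p' t *
       (\<Sum>q'<m. z p' q' t * B q' q t + deriv_on I (z p' q') t * B' q' q t)))"
proof -
  define \<Phi> where "\<Phi> = (\<lambda>z p q t. A p q t + (\<Sum>p'<a. n p p' t *
       (\<Sum>q'<m. z p' q' t * B q' q t + deriv_on I (z p' q') t * B' q' q t)))"
  define Z where "Z = (\<lambda>i. (\<Phi> ^^ i) (\<lambda>_ _ _. 0))"
  have Z0: "Z 0 = (\<lambda>_ _ _. 0)" and ZS: "Z (Suc i) = \<Phi> (Z i)" for i by (simp_all add: Z_def)
  have le: "k + enat i \<le> k + enat \<mu>" if "i \<le> \<mu>" for i using that by (simp add: add_left_mono)
  have smoothZ: "\<forall>p<a. \<forall>q<m. Ck_on (k + enat (\<mu> - i)) I (Z i p q)" if "i \<le> \<mu>" for i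
    using that
  proof (induction i)
    case 0
    then show ?case using I by (simp add: Z0 Ck_on_const)
  next
    case (Suc i)
    have "\<mu> - i = Suc (\<mu> - Suc i)" using Suc.prems by simp
    then have e: "k + enat (\<mu> - i) = k + enat (\<mu> - Suc i) + 1"
      by (simp add: one_enat_def add.assoc)
    have l: "k + enat (\<mu> - Suc i) \<le> k + enat \<mu>" "k + enat (\<mu> - Suc i) \<le> k + enat (\<mu> - i)"
      by (simp_all add: add_left_mono)
    have IH: "Ck_on (k + enat (\<mu> - i)) I (Z i p q)" if "p < a" "q < m" for p q
      using Suc that by simp
    have "Ck_on (k + enat (\<mu> - Suc i)) I (Z i p q)" "Ck_on (k + enat (\<mu> - Suc i)) I (deriv_on I (Z i p q))"
      if "p < a" "q < m" for p q
      using Ck_on_mono[OF I IH[OF that] l(2)] Ck_on_deriv_on[OF I IH[OF that, unfolded e]] by auto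
    then show ?case
      unfolding ZS \<Phi>_def
      by (auto intro!: Ck_on_add Ck_on_sum Ck_on_mult I smooth[THEN Ck_on_mono[OF I _ l(1)]])
  qed
  \<comment> \<open>Row \<open>p\<close> is final from iterate \<mu> - \<open>lev p\<close> on; for
    \<open>i = 0\<close> the claim is vacuous because \<open>lev p < \<mu>\<close>. Equality is
    asserted on all of \<open>I\<close>, as the next iterate compares derivatives too.\<close>
  have agree: "\<forall>p<a. \<forall>q<m. \<mu> \<le> lev p + i \<longrightarrow> (\<forall>t\<in>I. Z (Suc i) p q t = Z i p q t)" for i
  proof (induction i)
    case 0
    then show ?case using lev by fastforce
  next
    case (Suc i)
    show ?case
    proof (intro allI impI ballI)
      fix p q t assume p: "p < a" "q < m" "\<mu> \<le> lev p + Suc i" and t: "t \<in> I"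
      have "n p p' t * (\<Sum>q'<m. Z (Suc i) p' q' t * B q' q t + deriv_on I (Z (Suc i) p' q') t * B' q' q t)
          = n p p' t * (\<Sum>q'<m. Z i p' q' t * B q' q t + deriv_on I (Z i p' q') t * B' q' q t)"
        (is "?S (Suc i) p' = ?S i p'") if p': "p' < a" for p'
      proof (cases "lev p' \<le> lev p")
        case True
        then show ?thesis using nil[OF p(1) p' t] by simp
      next
        case False
        then have eq: "\<forall>t\<in>I. Z (Suc i) p' q' t = Z i p' q' t" if "q' < m" for q'
          using Suc p p' that by simp
        have "(\<Sum>q'<m. Z (Suc i) p' q' t * B q' q t + deriv_on I (Z (Suc i) p' q') t * B' q' q t)
            = (\<Sum>q'<m. Z i p' q' t * B q' q t + deriv_on I (Z i p' q') t * B' q' q t)"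
          using eq deriv_on_cong[OF eq t] t by (intro sum.cong) auto
        then show ?thesis by simp
      qed
      then have "(\<Sum>p'<a. ?S (Suc i) p') = (\<Sum>p'<a. ?S i p')" by (intro sum.cong) auto
      moreover have "Z (Suc j) p q t = A p q t + (\<Sum>p'<a. ?S j p')" for j
        by (simp only: ZS \<Phi>_def)
      ultimately show "Z (Suc (Suc i)) p q t = Z (Suc i) p q t" by simp
    qed
  qed
  show ?thesis
  proof (intro exI[of _ "Z \<mu>"] conjI)
    show "\<forall>p<a. \<forall>q<m. Ck_on k I (Z \<mu> p q)"
      using smoothZ[of \<mu>] by (simp add: zero_enat_def[symmetric])
    have "\<forall>t\<in>I. \<forall>p<a. \<forall>q<m. Z \<mu> p q t = \<Phi> (Z \<mu>) p q t"
      using agree[of \<mu>] by (simp add: ZS)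
    then show "\<forall>t\<in>I. \<forall>p<a. \<forall>q<m. Z \<mu> p q t = A p q t + (\<Sum>p'<a. n p p' t *
       (\<Sum>q'<m. Z \<mu> p' q' t * B q' q t + deriv_on I (Z \<mu> p' q') t * B' q' q t))"
      unfolding \<Phi>_def .
  qed
qed

section \<open>Normalising the nilpotent part\<close>

text \<open>\<open>N_Ec ls\<close> shifts columns, so R * \<open>N_Ec ls\<close> = N prescribes
  exactly the columns of \<open>R\<close> that have a successor. The remaining ones are chosen to
  make the diagonal blocks nonsingular: the prescribed part of diagonal block \<open>i\<close> is
  N_{i,i+1}, whose full column rank permits the completion.\<close>

lemma column_completion:
  assumes I: "perfect I" "I \<noteq> {}" and r: "1 \<le> r" and bs: "block_sizes ls"
    and N: "N \<in> SUT_column I ls" "Ck_mat_fun r I (sum_list ls) (sum_list ls) N"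
  shows "\<exists>R. Ck_mat_fun r I (sum_list ls) (sum_list ls) R \<and> (\<forall>t\<in>I. graded_inj ls (R t) \<and>
    (\<forall>p<sum_list ls. \<forall>q<sum_list ls. (blk ls q < blk ls p \<longrightarrow> R t $$ (p, q) = 0) \<and>
       (has_suc ls q \<longrightarrow> R t $$ (p, q) = N t $$ (p, suc_pos ls q))))"
proof -
  have N0: "N t $$ (p, q) = 0"
    if "t \<in> I" "p < sum_list ls" "q < sum_list ls" "blk ls q \<le> blk ls p" for t p q
    using N(1) that by (auto simp: SUT_column_def SUT_iff)
  have "\<exists>C. Ck_mat_fun r I (ls ! i) (ls ! i) C \<and> (\<forall>t\<in>I. det (C t) \<noteq> 0 \<and>
      (\<forall>x<ls ! i. \<forall>c. Suc i < length ls \<and> c < ls ! Suc i \<longrightarrow>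
         C t $$ (x, c) = N t $$ (offset ls i + x, offset ls (Suc i) + c)))"
    if i: "i < length ls" for i
  proof (cases "Suc i < length ls")
    case True
    have smooth: "Ck_mat_fun r I (ls ! i) (ls ! Suc i) (\<lambda>t. block ls i (Suc i) (N t))"
    proof (rule Ck_mat_funI)
      show "Ck_on r I (\<lambda>t. block ls i (Suc i) (N t) $$ (x, c))" if "x < ls ! i" "c < ls ! Suc i" for x c
        using that i True Ck_mat_funD(2)[OF N(2), of "offset ls i + x" "offset ls (Suc i) + c"]
        by (simp add: block_def offset_add_less)
    qed (simp add: block_def)
    have "\<forall>t\<in>I. \<forall>x\<in>carrier_vec (ls ! Suc i).
        block ls i (Suc i) (N t) *\<^sub>v x = 0\<^sub>v (ls ! i) \<longrightarrow> x = 0\<^sub>v (ls ! Suc i)"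
    proof (intro ballI impI)
      fix t x assume t: "t \<in> I" and x: "x \<in> carrier_vec (ls ! Suc i)"
        "block ls i (Suc i) (N t) *\<^sub>v x = 0\<^sub>v (ls ! i)"
      have "vec_space.rank (ls ! i) (block ls i (Suc i) (N t)) = ls ! Suc i"
        using N(1) t True by (auto simp: SUT_column_def)
      from full_col_rank_injective[OF Ck_mat_funD(1)[OF smooth t] this x]
      show "x = 0\<^sub>v (ls ! Suc i)" .
    qed
    from smooth_basis_completion[OF I r smooth this] show ?thesis
      by (auto simp: block_def)
  next
    case False
    then show ?thesis
      by (intro exI[of _ "\<lambda>_. 1\<^sub>m (ls ! i)"]) (simp add: Ck_mat_fun_const I)
  qed
  then obtain C where C: "\<And>i. i < length ls \<Longrightarrow> Ck_mat_fun r I (ls ! i) (ls ! i) (C i)"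
    "\<And>i t. i < length ls \<Longrightarrow> t \<in> I \<Longrightarrow> det (C i t) \<noteq> 0"
    "\<And>i t x c. Suc i < length ls \<Longrightarrow> t \<in> I \<Longrightarrow> x < ls ! i \<Longrightarrow> c < ls ! Suc i \<Longrightarrow>
       C i t $$ (x, c) = N t $$ (offset ls i + x, offset ls (Suc i) + c)"
    by (metis Suc_lessD)
  \<comment> \<open>Free columns are filled from \<open>C\<close> in their diagonal block only. A
    prescribed column is a column of \<open>N\<close> one block further on, and there strict
    triangularity of \<open>N\<close> amounts to block triangularity of \<open>R\<close>.\<close>
  define R where "R = (\<lambda>t. mat (sum_list ls) (sum_list ls) (\<lambda>(p, q).
      if has_suc ls q then N t $$ (p, suc_pos ls q)
      else if blk ls p = blk ls q
        then C (blk ls q) t $$ (p - offset ls (blk ls p), q - offset ls (blk ls q)) else 0))"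
  have "Ck_mat_fun r I (sum_list ls) (sum_list ls) R"
  proof (rule Ck_mat_funI)
    fix p q assume pq: "p < sum_list ls" "q < sum_list ls"
    consider "has_suc ls q" | "\<not> has_suc ls q" "blk ls p = blk ls q" | "\<not> has_suc ls q" "blk ls p \<noteq> blk ls q"
      by blast
    then show "Ck_on r I (\<lambda>t. R t $$ (p, q))"
    proof cases
      case 1
      then show ?thesis using pq suc_pos(1)[OF pq(2)] by (simp add: R_def Ck_mat_funD(2)[OF N(2)])
    next
      case 2
      have "p - offset ls (blk ls p) < ls ! blk ls p" "q - offset ls (blk ls q) < ls ! blk ls q"
        using blk_bounds[OF pq(1)] blk_bounds[OF pq(2)] by linarith+
      then show ?thesis
        using 2 pq blk_bounds(1)[OF pq(2)] by (simp add: R_def Ck_mat_funD(2)[OF C(1)])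
    next
      case 3
      then show ?thesis using pq I by (simp add: R_def Ck_on_const)
    qed
  qed (simp add: R_def)
  moreover have BUT: "R t $$ (p, q) = 0"
    if "t \<in> I" "p < sum_list ls" "q < sum_list ls" "blk ls q < blk ls p" for t p q
    using that suc_pos[of q ls] N0[of t p "suc_pos ls q"] by (simp add: R_def)
  moreover have "graded_inj ls (R t)" if t: "t \<in> I" for t
  proof (rule graded_injI[where C = "\<lambda>i. C i t"])
    fix i x c assume i: "i < length ls" "x < ls ! i" "c < ls ! i"
    show "R t $$ (offset ls i + x, offset ls i + c) = C i t $$ (x, c)"
      using i C(3)[OF _ t, of i x c]
      by (auto simp: R_def offset_add_less blk_offset_add has_suc_def suc_pos_def)
  qed (use t BUT C Ck_mat_funD(1)[OF C(1)] in \<open>auto simp: R_def\<close>)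
  ultimately show ?thesis
    by (intro exI[of _ R]) (simp add: R_def)
qed

text \<open>Multiplication by \<open>N_Ec ls\<close> puts column \<open>pre_pos ls q\<close> in
  place \<open>q\<close> and zero in the first block, where the strictly triangular \<open>N\<close>
  has zero columns as well.\<close>

lemma mult_N_Ec_eq:
  fixes N R :: "real mat"
  assumes bs: "block_sizes ls"
    and c: "N \<in> carrier_mat (sum_list ls) (sum_list ls)" "R \<in> carrier_mat (sum_list ls) (sum_list ls)"
    and N: "\<And>p q. p < sum_list ls \<Longrightarrow> q < sum_list ls \<Longrightarrow> blk ls q \<le> blk ls p \<Longrightarrow> N $$ (p, q) = 0"
    and R: "\<And>p q. p < sum_list ls \<Longrightarrow> q < sum_list ls \<Longrightarrow> has_suc ls q \<Longrightarrow> R $$ (p, q) = N $$ (p, suc_pos ls q)"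
  shows "R * N_Ec ls = N"
proof (rule eq_matI)
  fix p q assume "p < dim_row N" "q < dim_col N"
  then have pq: "p < sum_list ls" "q < sum_list ls" using c by auto
  show "(R * N_Ec ls) $$ (p, q) = N $$ (p, q)"
    using index_mult_N_Ec[OF bs c(2) pq] N[OF pq] R[OF pq(1)] pre_pos[OF bs pq(2)] by auto
qed (use c N_Ec_carrier[of ls] in auto)

text \<open>
  The defining equation of \<open>K\<close>, in which \<open>D\<close> plays the role of its derivative, is the
  componentwise form of \<open>N * K = (K + N * D) * N_Ec ls\<close>, with the columns that \<open>N_Ec ls\<close> does
  not reach taken from \<open>R\<close>.
\<close>

context
  fixes ls :: "nat list" and N R K D :: "real mat"
  assumes bs: "block_sizes ls"
    and cN: "N \<in> carrier_mat (sum_list ls) (sum_list ls)"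
    and cR: "R \<in> carrier_mat (sum_list ls) (sum_list ls)"
    and cK: "K \<in> carrier_mat (sum_list ls) (sum_list ls)"
    and cD: "D \<in> carrier_mat (sum_list ls) (sum_list ls)"
    and N: "\<And>p q. p < sum_list ls \<Longrightarrow> q < sum_list ls \<Longrightarrow> blk ls q \<le> blk ls p \<Longrightarrow> N $$ (p, q) = 0"
    and K: "\<And>p q. p < sum_list ls \<Longrightarrow> q < sum_list ls \<Longrightarrow> blk ls q < blk ls p \<Longrightarrow> K $$ (p, q) = 0"
    and D: "\<And>p q. p < sum_list ls \<Longrightarrow> q < sum_list ls \<Longrightarrow> blk ls q < blk ls p \<Longrightarrow> D $$ (p, q) = 0"
    and R: "\<And>p q. p < sum_list ls \<Longrightarrow> q < sum_list ls \<Longrightarrow> has_suc ls q \<Longrightarrow>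
              R $$ (p, q) = N $$ (p, suc_pos ls q)"
    and R_inj: "graded_inj ls R"
    and K_eq: "\<And>p q. p < sum_list ls \<Longrightarrow> q < sum_list ls \<Longrightarrow> K $$ (p, q) =
        (if has_suc ls q then \<Sum>p'<sum_list ls. N $$ (p, p') * (K $$ (p', suc_pos ls q) - D $$ (p', q))
         else R $$ (p, q))"
begin

text \<open>Outside the first block, column \<open>q\<close> is the equation \<open>K_eq\<close> at
  the predecessor of \<open>q\<close>, rearranged. In the first block the right side is zero by the
  shift, the left side because \<open>K\<close> has only its top block there and \<open>N\<close>
  annihilates that block.\<close>

lemma chain_transformation: "N * K = (K + N * D) * N_Ec ls"
proof (rule eq_matI)
  let ?a = "sum_list ls"
  fix p q assume "p < dim_row ((K + N * D) * N_Ec ls)" "q < dim_col ((K + N * D) * N_Ec ls)"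
  then have pq: "p < ?a" "q < ?a" using cN cD cK N_Ec_carrier[of ls] by auto
  have cM: "K + N * D \<in> carrier_mat ?a ?a" using cK cN cD by simp
  have NK: "(N * K) $$ (p, q) = (\<Sum>p'<?a. N $$ (p, p') * K $$ (p', q))"
    by (rule index_mult_mat_sum[OF cN cK pq])
  show "(N * K) $$ (p, q) = ((K + N * D) * N_Ec ls) $$ (p, q)"
  proof (cases "blk ls q = 0")
    case True
    have "N $$ (p, p') * K $$ (p', q) = 0" if "p' < ?a" for p'
      using N[OF pq(1) that] K[OF that pq(2)] True by (cases "blk ls p' = 0") auto
    then have "(N * K) $$ (p, q) = 0" unfolding NK by (intro sum.neutral) auto
    then show ?thesis using index_mult_N_Ec[OF bs cM pq] True by simp
  next
    case False
    note pre = pre_pos[OF bs pq(2) False]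
    have "((K + N * D) * N_Ec ls) $$ (p, q) = K $$ (p, pre_pos ls q) + (N * D) $$ (p, pre_pos ls q)"
      unfolding index_mult_N_Ec[OF bs cM pq] using False pq pre(1) cK cN cD by simp
    also have "(N * D) $$ (p, pre_pos ls q) = (\<Sum>p'<?a. N $$ (p, p') * D $$ (p', pre_pos ls q))"
      by (rule index_mult_mat_sum[OF cN cD pq(1) pre(1)])
    also have "K $$ (p, pre_pos ls q) =
        (\<Sum>p'<?a. N $$ (p, p') * (K $$ (p', q) - D $$ (p', pre_pos ls q)))"
      using K_eq[OF pq(1) pre(1)] pre(3,4) by simp
    finally show ?thesis unfolding NK by (simp add: algebra_simps sum_subtractf)
  qed
qed (use cN cD cK N_Ec_carrier[of ls] in auto)

text \<open>On diagonal blocks \<open>K_eq\<close> reads K_ii = R_ii diag(K_jj, 1) with j = i + 1,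
  where diag(K_jj, 1) acts on the columns with and without successor. Hence injectivity passes from
  block i + 1 to block i. The argument is carried out on vectors: \<open>w\<close> is the shifted
  \<open>x\<close>, \<open>y\<close> its image under \<open>K\<close>, and \<open>z\<close> is
  diag(K_jj, 1) applied to \<open>x\<close>.\<close>

lemma chain_graded_inj: "graded_inj ls K"
proof -
  let ?a = "sum_list ls"
  have step: "low ls i x"
    if i: "i < length ls" and x: "x \<in> carrier_vec ?a" "low ls (Suc i) x" and Kx: "low ls i (K *\<^sub>v x)"
      and IH: "\<And>w. Suc i < length ls \<Longrightarrow> w \<in> carrier_vec ?a \<Longrightarrow> low ls (Suc (Suc i)) w \<Longrightarrow>
        low ls (Suc i) (K *\<^sub>v w) \<Longrightarrow> low ls (Suc i) w"
    for i x
  proof -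
    \<comment> \<open>This is the transpose of \<open>N_Ec ls\<close> applied to \<open>x\<close>:
      it moves the components with a successor one block further and drops the others.\<close>
    define w where "w = vec ?a (\<lambda>q. if blk ls q = 0 then 0 else vec_index x (pre_pos ls q))"
    have cw: "w \<in> carrier_vec ?a" by (simp add: w_def)
    have w: "low ls (Suc (Suc i)) w"
      unfolding low_def
    proof (intro allI impI)
      fix q assume q: "q < ?a" "Suc (Suc i) \<le> blk ls q"
      then show "vec_index w q = 0"
        using pre_pos[OF bs q(1)] x(2) by (simp add: w_def low_def)
    qed
    define y where "y = K *\<^sub>v w"
    have y: "vec_index y p = (\<Sum>q<?a. K $$ (p, q) * vec_index w q)" if "p < ?a" for p
      unfolding y_def by (rule index_mult_mat_vec_sum[OF cK cw that])
    have y_low: "low ls (Suc (Suc i)) y"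
      unfolding low_def
    proof (intro allI impI)
      fix p assume p: "p < ?a" "Suc (Suc i) \<le> blk ls p"
      have "K $$ (p, q) * vec_index w q = 0" if "q < ?a" for q
        using K[OF p(1) that] w that p by (cases "blk ls q < blk ls p") (auto simp: low_def)
      then show "vec_index y p = 0" unfolding y[OF p(1)] by (intro sum.neutral) auto
    qed
    have yx: "(\<Sum>q<?a. if has_suc ls q then K $$ (p, suc_pos ls q) * vec_index x q else 0) = vec_index y p"
      if "p < ?a" for p
    proof -
      have "(\<Sum>q<?a. if has_suc ls q then K $$ (p, suc_pos ls q) * vec_index x q else 0) =
          (\<Sum>q<?a. if blk ls q = 0 then 0 else K $$ (p, q) * vec_index x (pre_pos ls q))"
        by (rule sum_suc_pos[OF bs, of "\<lambda>q q'. K $$ (p, q') * vec_index x q"])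
      also have "\<dots> = (\<Sum>q<?a. K $$ (p, q) * vec_index w q)"
        by (intro sum.cong) (auto simp: w_def)
      finally show ?thesis using y[OF that] by simp
    qed
    \<comment> \<open>\<open>z\<close> is built so that \<open>K *\<^sub>v x\<close> and
      \<open>R *\<^sub>v z\<close> agree in the rows from block \<open>i\<close> on: the successor
      columns of \<open>K\<close> are \<open>N\<close> applied to \<open>K\<close>, up to a
      derivative term, and \<open>N\<close> there consists of columns of \<open>R\<close>.\<close>
    define z where "z = vec ?a (\<lambda>q. if has_suc ls q then vec_index y (suc_pos ls q) else vec_index x q)"
    have cz: "z \<in> carrier_vec ?a" by (simp add: z_def)
    have z: "low ls (Suc i) z"
      unfolding low_def
    proof (intro allI impI)
      fix q assume q: "q < ?a" "Suc i \<le> blk ls q"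
      then show "vec_index z q = 0"
        using suc_pos[OF q(1)] y_low x(2) by (auto simp: z_def low_def)
    qed
    have "vec_index (R *\<^sub>v z) p = 0" if p: "p < ?a" "i \<le> blk ls p" for p
    proof -
      \<comment> \<open>The derivative is invisible here: a nonzero factor of \<open>N\<close>
        forces the block of \<open>p'\<close> beyond \<open>i\<close>, then a nonzero factor of
        \<open>D\<close> forces the block of \<open>q\<close> beyond \<open>i\<close>, where
        \<open>x\<close> vanishes.\<close>
      have D0: "N $$ (p, p') * (D $$ (p', q) * vec_index x q) = 0" if "p' < ?a" "q < ?a" for p' q
        using N[OF p(1) that(1)] D[OF that] x(2) p that
        by (cases "blk ls p' \<le> blk ls p"; cases "blk ls q < blk ls p'") (auto simp: low_def)
      have E: "(\<Sum>p'<?a. N $$ (p, p') * (K $$ (p', suc_pos ls q) - D $$ (p', q))) * vec_index x q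
          = (\<Sum>p'<?a. N $$ (p, p') * (K $$ (p', suc_pos ls q) * vec_index x q))" if "q < ?a" for q
        unfolding sum_distrib_right
      proof (rule sum.cong[OF refl])
        fix p' assume "p' \<in> {..<?a}"
        then show "N $$ (p, p') * (K $$ (p', suc_pos ls q) - D $$ (p', q)) * vec_index x q
            = N $$ (p, p') * (K $$ (p', suc_pos ls q) * vec_index x q)"
          using D0[of p' q] that by (simp only: lessThan_iff left_diff_distrib right_diff_distrib mult.assoc diff_zero)
      qed
      have "(\<Sum>q<?a. if has_suc ls q
            then (\<Sum>p'<?a. N $$ (p, p') * (K $$ (p', suc_pos ls q) - D $$ (p', q))) * vec_index x q else 0)
          = (\<Sum>q<?a. \<Sum>p'<?a. N $$ (p, p') *
              (if has_suc ls q then K $$ (p', suc_pos ls q) * vec_index x q else 0))"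
        using E by (intro sum.cong) auto
      also have "\<dots> = (\<Sum>p'<?a. N $$ (p, p') * vec_index y p')"
        by (subst sum.swap) (simp add: sum_distrib_left[symmetric] yx)
      also have "\<dots> = (\<Sum>p'<?a. if blk ls p' = 0 then 0 else N $$ (p, p') * vec_index y p')"
        using N[OF p(1)] by (intro sum.cong) auto
      also have "\<dots> = (\<Sum>q<?a. if has_suc ls q then N $$ (p, suc_pos ls q) * vec_index y (suc_pos ls q) else 0)"
        by (rule sum_suc_pos[OF bs, of "\<lambda>_ p'. N $$ (p, p') * vec_index y p'", symmetric])
      finally have S: "(\<Sum>q<?a. if has_suc ls q
            then (\<Sum>p'<?a. N $$ (p, p') * (K $$ (p', suc_pos ls q) - D $$ (p', q))) * vec_index x q else 0)
          = (\<Sum>q<?a. if has_suc ls q then N $$ (p, suc_pos ls q) * vec_index y (suc_pos ls q) else 0)" .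
      have "vec_index (K *\<^sub>v x) p = (\<Sum>q<?a. K $$ (p, q) * vec_index x q)"
        by (rule index_mult_mat_vec_sum[OF cK x(1) p(1)])
      also have "\<dots> = (\<Sum>q<?a. (if has_suc ls q
            then (\<Sum>p'<?a. N $$ (p, p') * (K $$ (p', suc_pos ls q) - D $$ (p', q))) * vec_index x q else 0)
          + (if has_suc ls q then 0 else R $$ (p, q) * vec_index x q))"
        using K_eq[OF p(1)] by (intro sum.cong) auto
      also have "\<dots> = (\<Sum>q<?a. (if has_suc ls q then N $$ (p, suc_pos ls q) * vec_index y (suc_pos ls q) else 0)
          + (if has_suc ls q then 0 else R $$ (p, q) * vec_index x q))"
        unfolding sum.distrib S ..
      also have "\<dots> = (\<Sum>q<?a. R $$ (p, q) * vec_index z q)"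
        using R[OF p(1)] by (intro sum.cong) (auto simp: z_def)
      also have "\<dots> = vec_index (R *\<^sub>v z) p"
        using index_mult_mat_vec_sum[OF cR cz p(1)] by simp
      finally show ?thesis using Kx p by (simp add: low_def)
    qed
    then have z0: "low ls i z"
      using R_inj i cz z by (auto simp: graded_inj_def low_def)
    have "low ls (Suc i) y"
      unfolding low_def
    proof (intro allI impI)
      fix p assume p: "p < ?a" "Suc i \<le> blk ls p"
      then have b: "blk ls p \<noteq> 0" by simp
      note pre = pre_pos[OF bs p(1) b]
      have "vec_index z (pre_pos ls p) = 0" using z0 pre(1,2) p unfolding low_def by (metis Suc_le_mono)
      then show "vec_index y p = 0" using pre by (simp add: z_def)
    qed
    then have w0: "low ls (Suc i) w" if "Suc i < length ls"
      using IH[OF that cw w] by (simp add: y_def)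
    show ?thesis
      unfolding low_def
    proof (intro allI impI)
      fix q assume q: "q < ?a" "i \<le> blk ls q"
      show "vec_index x q = 0"
      proof (cases "has_suc ls q")
        case True
        note s = suc_pos[OF q(1) True]
        \<comment> \<open>The hypothesis on the next block enters only through an index that has a
          successor. The last block has none; there \<open>z\<close> equals \<open>x\<close>, and
          injectivity of \<open>R\<close> alone starts the recursion.\<close>
        have "Suc i < length ls" using True q by (simp add: has_suc_def)
        then have "vec_index w (suc_pos ls q) = 0" using w0 s q by (simp add: low_def)
        then show ?thesis using s by (simp add: w_def)
      next
        case False
        then show ?thesis using z0 q by (auto simp: low_def z_def)
      qed
    qed
  qed
  have "low ls i x" if "i < length ls" "x \<in> carrier_vec ?a" "low ls (Suc i) x" "low ls i (K *\<^sub>v x)" for i x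
    using that
  proof (induction "length ls - i" arbitrary: i x rule: less_induct)
    case less
    show ?case
    proof (rule step[OF less.prems])
      fix w assume "Suc i < length ls" "w \<in> carrier_vec ?a" "low ls (Suc (Suc i)) w" "low ls (Suc i) (K *\<^sub>v w)"
      then show "low ls (Suc i) w" using less.hyps[of "Suc i" w] less.prems(1) by simp
    qed
  qed
  then show ?thesis unfolding graded_inj_def by blast
qed

text \<open>The product of the strictly triangular \<open>N\<close> and the triangular
  \<open>D\<close> is strictly triangular, hence invisible to \<open>graded_inj\<close>.\<close>

lemma chain_sum_graded_inj: "graded_inj ls (K + N * D)"
proof (rule graded_inj_cong[OF cK _ chain_graded_inj])
  let ?a = "sum_list ls"
  show "K + N * D \<in> carrier_mat ?a ?a" using cK cN cD by simp
  fix p q assume pq: "p < ?a" "q < ?a" "blk ls q \<le> blk ls p"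
  have "N $$ (p, p') * D $$ (p', q) = 0" if "p' < ?a" for p'
    using N[OF pq(1) that] D[OF that pq(2)] pq(3) by (cases "blk ls p' \<le> blk ls p") auto
  then have "(N * D) $$ (p, q) = 0"
    unfolding index_mult_mat_sum[OF cN cD pq(1,2)] by (intro sum.neutral) auto
  then show "(K + N * D) $$ (p, q) = K $$ (p, q)" using pq cK cN cD by simp
qed

end

section \<open>Simultaneous reduction of \<open>N\<close> and the identity\<close>

lemma nilpotent_normal_form:
  assumes I: "perfect I" and bs: "block_sizes ls" and a: "a = sum_list ls"
    and N: "N \<in> SUT I ls" "Ck_mat_fun (k + 1 + enat (length ls)) I a a N"
    and R: "Ck_mat_fun (k + 1 + enat (length ls)) I a a R"
    and R_inj: "\<And>t. t \<in> I \<Longrightarrow> graded_inj ls (R t)"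
    and R_BUT: "\<And>t p q. t \<in> I \<Longrightarrow> p < a \<Longrightarrow> q < a \<Longrightarrow> blk ls q < blk ls p \<Longrightarrow> R t $$ (p, q) = 0"
    and R_suc: "\<And>t p q. t \<in> I \<Longrightarrow> p < a \<Longrightarrow> q < a \<Longrightarrow> has_suc ls q \<Longrightarrow> R t $$ (p, q) = N t $$ (p, suc_pos ls q)"
  shows "\<exists>K L. Ck_mat_fun k I a a K \<and> Ck_mat_fun k I a a L \<and> (\<forall>t\<in>I. det (K t) \<noteq> 0 \<and> det (L t) \<noteq> 0 \<and>
    L t * N t * K t = N_Ec ls \<and> L t * (K t + N t * mat_fun_deriv I a a K t) = 1\<^sub>m a)"
proof -
  let ?r = "k + 1 + enat (length ls)"
  have N0: "N t $$ (p, q) = 0" if "t \<in> I" "p < a" "q < a" "blk ls q \<le> blk ls p" for t p q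
    using N(1) that by (auto simp: SUT_iff a)
  \<comment> \<open>With J = \<open>N_Ec ls\<close> and J^T its transpose, \<open>B\<close> is J^T
    and \<open>B'\<close> is -J J^T, minus the projection onto the indices with a successor;
    \<open>A\<close> keeps the free columns of \<open>R\<close>. The equation solved is K = R (1 - J
    J^T) + N (K J^T - K' J J^T). It is solved in class k + 1, so that K' and with it
    \<open>L\<close> are of class k.\<close>
  define B where "B = (\<lambda>q' q (t :: real). if has_suc ls q \<and> q' = suc_pos ls q then 1 else 0 :: real)"
  define B' where "B' = (\<lambda>q' q (t :: real). if has_suc ls q \<and> q' = q then -1 else 0 :: real)"
  define A where "A = (\<lambda>p q t. if has_suc ls q then 0 else R t $$ (p, q))"
  obtain z where z: "\<And>p q. p < a \<Longrightarrow> q < a \<Longrightarrow> Ck_on (k + 1) I (z p q)"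
    and zeq: "\<And>t p q. t \<in> I \<Longrightarrow> p < a \<Longrightarrow> q < a \<Longrightarrow> z p q t = A p q t + (\<Sum>p'<a. N t $$ (p, p') *
       (\<Sum>q'<a. z p' q' t * B q' q t + deriv_on I (z p' q') t * B' q' q t))"
  proof -
    have "\<exists>z. (\<forall>p<a. \<forall>q<a. Ck_on (k + 1) I (z p q)) \<and>
      (\<forall>t\<in>I. \<forall>p<a. \<forall>q<a. z p q t = A p q t + (\<Sum>p'<a. N t $$ (p, p') *
         (\<Sum>q'<a. z p' q' t * B q' q t + deriv_on I (z p' q') t * B' q' q t)))"
    proof (rule nilpotent_differential_equation[OF I, where lev = "blk ls" and \<mu> = "length ls"])
      show "blk ls p < length ls" if "p < a" for p using that by (simp add: a blk_bounds)
      show "Ck_on ?r I (A p q)" if "p < a" "q < a" for p q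
        using that by (cases "has_suc ls q") (simp_all add: A_def Ck_on_const I Ck_mat_funD(2)[OF R])
      show "Ck_on ?r I (B q q')" "Ck_on ?r I (B' q q')" for q q'
        by (simp_all add: B_def B'_def Ck_on_const I)
    qed (simp_all add: N0 Ck_mat_funD(2)[OF N(2)])
    then show ?thesis using that by blast
  qed
  define K where "K = (\<lambda>t. mat a a (\<lambda>(p, q). z p q t))"
  let ?D = "mat_fun_deriv I a a K"
  have Kz: "K t $$ (p, q) = z p q t" if "p < a" "q < a" for p q t using that by (simp add: K_def)
  have Dz: "?D t $$ (p, q) = deriv_on I (z p q) t" if "p < a" "q < a" for p q t
    using that by (simp add: index_mat_fun_deriv Kz)
  have K_eq: "K t $$ (p, q) = (if has_suc ls q
      then \<Sum>p'<a. N t $$ (p, p') * (K t $$ (p', suc_pos ls q) - ?D t $$ (p', q)) else R t $$ (p, q))"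
    if t: "t \<in> I" and pq: "p < a" "q < a" for t p q
  proof -
    have "(\<Sum>q'<a. z p' q' t * B q' q t + deriv_on I (z p' q') t * B' q' q t) =
        (if has_suc ls q then K t $$ (p', suc_pos ls q) - ?D t $$ (p', q) else 0)" if p': "p' < a" for p'
    proof (cases "has_suc ls q")
      case True
      have s: "suc_pos ls q < a" using suc_pos(1)[OF _ True] pq by (simp add: a)
      have "(\<Sum>q'<a. z p' q' t * B q' q t + deriv_on I (z p' q') t * B' q' q t) =
          (\<Sum>q'<a. (if q' = suc_pos ls q then z p' q' t else 0) - (if q' = q then deriv_on I (z p' q') t else 0))"
        using True by (intro sum.cong) (auto simp: B_def B'_def)
      also have "\<dots> = z p' (suc_pos ls q) t - deriv_on I (z p' q) t"
        using s pq by (simp add: sum_subtractf)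
      finally show ?thesis using True p' s pq by (simp add: Kz Dz)
    qed (simp add: B_def B'_def)
    then show ?thesis using zeq[OF t pq] pq by (simp add: Kz A_def)
  qed
  \<comment> \<open>Triangularity of \<open>K\<close> is proved from the last block row upwards,
    since \<open>N\<close> refers each row to later blocks. Passing to \<open>suc_pos ls q\<close>
    raises the column block by one, which the strictly larger row block absorbs. The point
    \<open>t\<close> must vary in the induction: \<open>z p' q\<close> has to vanish on all of
    \<open>I\<close> for its derivative to vanish.\<close>
  have zero: "z p q t = 0" if "t \<in> I" "p < a" "q < a" "blk ls q < blk ls p" for t p q
    using that
  proof (induction "length ls - blk ls p" arbitrary: p q t rule: less_induct)
    case less
    have "K t $$ (p, q) = 0"
    proof (cases "has_suc ls q")
      case True
      note s = suc_pos[OF _ True]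
      have "N t $$ (p, p') * (K t $$ (p', suc_pos ls q) - ?D t $$ (p', q)) = 0" if p': "p' < a" for p'
      proof (cases "blk ls p' \<le> blk ls p")
        case True
        then show ?thesis using N0 less.prems p' by simp
      next
        case False
        have m: "length ls - blk ls p' < length ls - blk ls p"
          using False blk_bounds(1)[of p ls] less.prems(2) by (simp add: a)
        have "\<forall>t\<in>I. z p' q t = 0" using less.hyps[OF m _ p'] less.prems False by auto
        then have "deriv_on I (z p' q) t = deriv_on I (\<lambda>_. 0) t"
          using less.prems(1) by (intro deriv_on_cong) auto
        also have "\<dots> = 0" by (rule deriv_on_eq[OF I less.prems(1)]) simp
        finally have "?D t $$ (p', q) = 0" using Dz p' less.prems by simp
        moreover have "K t $$ (p', suc_pos ls q) = 0"
          using less.hyps[OF m less.prems(1) p', of "suc_pos ls q"] s less.prems False p'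
          by (simp add: a Kz)
        ultimately show ?thesis by simp
      qed
      then have "(\<Sum>p'<a. N t $$ (p, p') * (K t $$ (p', suc_pos ls q) - ?D t $$ (p', q))) = 0"
        by (intro sum.neutral) auto
      then show ?thesis using K_eq[OF less.prems(1-3)] True by simp
    next
      case False
      then show ?thesis using K_eq[OF less.prems(1-3)] R_BUT less.prems by simp
    qed
    then show ?case using Kz less.prems by simp
  qed
  have D0: "?D t $$ (p, q) = 0" if "t \<in> I" "p < a" "q < a" "blk ls q < blk ls p" for t p q
  proof -
    have "deriv_on I (z p q) t = deriv_on I (\<lambda>_. 0) t"
      using zero that by (intro deriv_on_cong) auto
    also have "\<dots> = 0" by (rule deriv_on_eq[OF I that(1)]) simp
    finally show ?thesis using Dz that by simp
  qed
  have K1: "Ck_mat_fun (k + 1) I a a K"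
    by (rule Ck_mat_funI) (simp_all add: K_def z)
  have le: "k \<le> k + 1" "k \<le> ?r" by (simp_all add: add.assoc)
  have Kk: "Ck_mat_fun k I a a K" by (rule Ck_mat_fun_mono[OF I K1 le(1)])
  have M: "Ck_mat_fun k I a a (\<lambda>t. K t + N t * ?D t)"
    by (rule Ck_mat_fun_add[OF I Kk Ck_mat_fun_mult[OF I Ck_mat_fun_mono[OF I N(2) le(2)]
          Ck_mat_fun_deriv[OF I K1]]])
  note cs = Ck_mat_funD(1)[OF N(2)] Ck_mat_funD(1)[OF R] Ck_mat_funD(1)[OF Kk]
  have chain: "N t * K t = (K t + N t * ?D t) * N_Ec ls" "graded_inj ls (K t)" "graded_inj ls (K t + N t * ?D t)"
    if t: "t \<in> I" for t
  proof -
    note prems = bs cs[OF t, unfolded a] mat_fun_deriv_carrier[of I a a K t, unfolded a]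
    have zK: "K t $$ (p, q) = 0" if "p < a" "q < a" "blk ls q < blk ls p" for p q
      using zero[OF t that] Kz that by simp
    show "N t * K t = (K t + N t * ?D t) * N_Ec ls"
      unfolding a by (rule chain_transformation[OF prems])
        (use t N0 zK D0 R_suc R_inj K_eq in \<open>simp_all add: a\<close>)
    show "graded_inj ls (K t)"
      by (rule chain_graded_inj[OF prems])
        (use t N0 zK D0 R_suc R_inj K_eq in \<open>simp_all add: a\<close>)
    show "graded_inj ls (K t + N t * ?D t)"
      unfolding a by (rule chain_sum_graded_inj[OF prems])
        (use t N0 zK D0 R_suc R_inj K_eq in \<open>simp_all add: a\<close>)
  qed
  have "\<forall>t\<in>I. det (K t + N t * ?D t) \<noteq> 0"
    using graded_inj_det[OF chain(3)] Ck_mat_funD(1)[OF M] by (simp add: a)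
  from Ck_mat_fun_inverse_exists[OF I M this] obtain L where L: "Ck_mat_fun k I a a L"
    and Linv: "\<And>t. t \<in> I \<Longrightarrow> (K t + N t * ?D t) * L t = 1\<^sub>m a" "\<And>t. t \<in> I \<Longrightarrow> L t * (K t + N t * ?D t) = 1\<^sub>m a"
    by blast
  have "L t * N t * K t = N_Ec ls" if t: "t \<in> I" for t
  proof -
    note c = Ck_mat_funD(1)[OF L t] cs[OF t] Ck_mat_funD(1)[OF M t] N_Ec_carrier[of ls, folded a]
    have "L t * N t * K t = L t * ((K t + N t * ?D t) * N_Ec ls)"
      using assoc_mult_mat[OF c(1,2,4)] chain(1)[OF t] by simp
    also have "\<dots> = (L t * (K t + N t * ?D t)) * N_Ec ls"
      by (rule assoc_mult_mat[OF c(1,5,6), symmetric])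
    finally show ?thesis using Linv(2)[OF t] c(6) by simp
  qed
  moreover have "det (L t) \<noteq> 0" if t: "t \<in> I" for t
    using det_mult[OF Ck_mat_funD(1)[OF M t] Ck_mat_funD(1)[OF L t]] Linv(1)[OF t] by auto
  moreover have "det (K t) \<noteq> 0" if t: "t \<in> I" for t
    using graded_inj_det[OF chain(2)[OF t]] cs(3)[OF t] by (simp add: a)
  ultimately show ?thesis using Kk L Linv(2) by (intro exI[of _ K] exI[of _ L]) simp
qed

section \<open>Eliminating the lower left block\<close>

text \<open>If the right factor has lower left block \<open>Y\<close> and the left factor has -L N
  Y, which keeps the first matrix block diagonal, then the new lower left block of the second matrix
  is L (G + Y + N Y' - N Y \<Omega>). Solved for \<open>Y\<close>, its vanishing reads Y = -G + N (Y
  \<Omega> - Y'), so \<open>B\<close> is \<Omega> and \<open>B'\<close> is minus the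
  identity.\<close>

lemma lower_left_elimination:
  assumes I: "perfect I" and a: "a = sum_list ls"
    and N: "N \<in> SUT I ls" "Ck_mat_fun (k + enat (length ls)) I a a N"
    and G: "Ck_mat_fun (k + enat (length ls)) I a d G"
    and \<Omega>: "Ck_mat_fun (k + enat (length ls)) I d d \<Omega>"
  shows "\<exists>Y. Ck_mat_fun k I a d Y \<and>
    (\<forall>t\<in>I. G t + Y t + N t * mat_fun_deriv I a d Y t = N t * (Y t * \<Omega> t))"
proof -
  let ?r = "k + enat (length ls)"
  define B' where "B' = (\<lambda>(q' :: nat) q (t :: real). if q' = q then -1 else 0 :: real)"
  have "\<exists>z. (\<forall>p<a. \<forall>q<d. Ck_on k I (z p q)) \<and>
    (\<forall>t\<in>I. \<forall>p<a. \<forall>q<d. z p q t = - G t $$ (p, q) + (\<Sum>p'<a. N t $$ (p, p') *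
       (\<Sum>q'<d. z p' q' t * \<Omega> t $$ (q', q) + deriv_on I (z p' q') t * B' q' q t)))"
  proof (rule nilpotent_differential_equation[OF I, where lev = "blk ls" and \<mu> = "length ls"])
    show "blk ls p < length ls" if "p < a" for p using that by (simp add: a blk_bounds)
    show "N t $$ (p, p') = 0" if "p < a" "p' < a" "t \<in> I" "blk ls p' \<le> blk ls p" for p p' t
      using N(1) that by (auto simp: SUT_iff a)
    show "Ck_on ?r I (\<lambda>t. - G t $$ (p, q))" if "p < a" "q < d" for p q
      using that by (intro Ck_on_uminus I Ck_mat_funD(2)[OF G])
    show "Ck_on ?r I (B' q q')" for q q' by (simp add: B'_def Ck_on_const I)
  qed (simp_all add: Ck_mat_funD(2)[OF N(2)] Ck_mat_funD(2)[OF \<Omega>])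
  then obtain z where z: "\<And>p q. p < a \<Longrightarrow> q < d \<Longrightarrow> Ck_on k I (z p q)"
    and zeq: "\<And>t p q. t \<in> I \<Longrightarrow> p < a \<Longrightarrow> q < d \<Longrightarrow>
      z p q t = - G t $$ (p, q) + (\<Sum>p'<a. N t $$ (p, p') *
       (\<Sum>q'<d. z p' q' t * \<Omega> t $$ (q', q) + deriv_on I (z p' q') t * B' q' q t))"
    by blast
  define Y where "Y = (\<lambda>t. mat a d (\<lambda>(p, q). z p q t))"
  let ?D = "mat_fun_deriv I a d Y"
  have cY: "Y t \<in> carrier_mat a d" for t by (simp add: Y_def)
  have Yz: "Y t $$ (p, q) = z p q t" if "p < a" "q < d" for p q t using that by (simp add: Y_def)
  have Dz: "?D t $$ (p, q) = deriv_on I (z p q) t" if "p < a" "q < d" for p q t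
    using that by (simp add: index_mat_fun_deriv Yz)
  have "G t + Y t + N t * ?D t = N t * (Y t * \<Omega> t)" if t: "t \<in> I" for t
  proof (rule eq_matI)
    note c = Ck_mat_funD(1)[OF N(2) t] Ck_mat_funD(1)[OF G t] Ck_mat_funD(1)[OF \<Omega> t]
      mat_fun_deriv_carrier[of I a d Y t] cY[of t]
    have cYO: "Y t * \<Omega> t \<in> carrier_mat a d" using c by simp
    fix p q assume "p < dim_row (N t * (Y t * \<Omega> t))" "q < dim_col (N t * (Y t * \<Omega> t))"
    then have pq: "p < a" "q < d" using c by auto
    have "(\<Sum>q'<d. z p' q' t * \<Omega> t $$ (q', q) + deriv_on I (z p' q') t * B' q' q t)
        = (Y t * \<Omega> t) $$ (p', q) - ?D t $$ (p', q)" if p': "p' < a" for p'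
    proof -
      have "(\<Sum>q'<d. z p' q' t * \<Omega> t $$ (q', q) + deriv_on I (z p' q') t * B' q' q t)
          = (\<Sum>q'<d. Y t $$ (p', q') * \<Omega> t $$ (q', q) - (if q' = q then ?D t $$ (p', q) else 0))"
        using p' pq by (intro sum.cong) (auto simp: B'_def Yz Dz)
      also have "\<dots> = (Y t * \<Omega> t) $$ (p', q) - ?D t $$ (p', q)"
        using index_mult_mat_sum[OF c(5,3) p' pq(2)] pq by (simp add: sum_subtractf)
      finally show ?thesis .
    qed
    then have "Y t $$ (p, q) = - G t $$ (p, q) +
        (\<Sum>p'<a. N t $$ (p, p') * ((Y t * \<Omega> t) $$ (p', q) - ?D t $$ (p', q)))"
      using zeq[OF t pq] pq by (simp add: Yz)
    also have "\<dots> = - G t $$ (p, q) + ((N t * (Y t * \<Omega> t)) $$ (p, q) - (N t * ?D t) $$ (p, q))"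
      unfolding index_mult_mat_sum[OF c(1) cYO pq] index_mult_mat_sum[OF c(1,4) pq]
      by (simp add: algebra_simps sum_subtractf)
    finally show "(G t + Y t + N t * ?D t) $$ (p, q) = (N t * (Y t * \<Omega> t)) $$ (p, q)"
      using c pq by simp
  next
    show "dim_row (G t + Y t + N t * ?D t) = dim_row (N t * (Y t * \<Omega> t))"
      "dim_col (G t + Y t + N t * ?D t) = dim_col (N t * (Y t * \<Omega> t))"
      using Ck_mat_funD(1)[OF N(2) t] Ck_mat_funD(1)[OF \<Omega> t] mat_fun_deriv_carrier[of I a d Y t] by auto
  qed
  moreover have "Ck_mat_fun k I a d Y"
    by (rule Ck_mat_funI) (simp_all add: cY Yz z)
  ultimately show ?thesis by blast
qed

section \<open>Block lower triangular pairs\<close>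

lemma invertible_mat_if_det_nonzero:
  fixes A :: "real mat"
  assumes "A \<in> carrier_mat n n" "det A \<noteq> 0"
  shows "invertible_mat A"
  using det_non_zero_imp_unit[OF assms, of "()"] assms(1)
  by (auto simp: Units_def ring_mat_def invertible_mat_def inverts_mat_def)

lemma mult_block_lower:
  fixes A1 :: "real mat"
  assumes "A1 \<in> carrier_mat d d" "A3 \<in> carrier_mat a d" "A4 \<in> carrier_mat a a"
    and "B1 \<in> carrier_mat d d" "B3 \<in> carrier_mat a d" "B4 \<in> carrier_mat a a"
  shows "four_block_mat A1 (0\<^sub>m d a) A3 A4 * four_block_mat B1 (0\<^sub>m d a) B3 B4 =
    four_block_mat (A1 * B1) (0\<^sub>m d a) (A3 * B1 + A4 * B3) (A4 * B4)"
  by (subst mult_four_block_mat[OF assms(1) zero_carrier_mat assms(2-4) zero_carrier_mat assms(5,6)])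
    (use assms in simp)

lemma add_block_lower:
  fixes A1 :: "real mat"
  assumes "A1 \<in> carrier_mat d d" "A3 \<in> carrier_mat a d" "A4 \<in> carrier_mat a a"
    and "B1 \<in> carrier_mat d d" "B3 \<in> carrier_mat a d" "B4 \<in> carrier_mat a a"
  shows "four_block_mat A1 (0\<^sub>m d a) A3 A4 + four_block_mat B1 (0\<^sub>m d a) B3 B4 =
    four_block_mat (A1 + B1) (0\<^sub>m d a) (A3 + B3) (A4 + B4)"
  by (subst add_four_block_mat[OF assms(1) zero_carrier_mat assms(2-4) zero_carrier_mat assms(5,6)]) simp

lemma deriv_on_const: "perfect I \<Longrightarrow> t \<in> I \<Longrightarrow> deriv_on I (\<lambda>_. c) t = 0"
  by (rule deriv_on_eq) auto

lemma mat_fun_deriv_const: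
  assumes "perfect I" "t \<in> I"
  shows "mat_fun_deriv I n m (\<lambda>_. A) t = 0\<^sub>m n m"
  by (rule eq_matI) (simp_all add: index_mat_fun_deriv deriv_on_const[OF assms] carrier_matD[OF mat_fun_deriv_carrier])

lemma mat_fun_deriv_block_lower:
  assumes I: "perfect I" "t \<in> I" and Y: "mat_fun_on I a d Y" and K: "mat_fun_on I a a K"
  shows "mat_fun_deriv I (d + a) (d + a) (F_form d a (\<lambda>_. 1\<^sub>m d) Y K) t =
    four_block_mat (0\<^sub>m d d) (0\<^sub>m d a) (mat_fun_deriv I a d Y t) (mat_fun_deriv I a a K t)" (is "?L = ?R")
proof (rule eq_matI)
  note c = mat_fun_deriv_carrier[of I a d Y t] mat_fun_deriv_carrier[of I a a K t]
  fix i j assume "i < dim_row ?R" "j < dim_col ?R"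
  then have ij: "i < d + a" "j < d + a" using c by auto
  have ent: "\<forall>s\<in>I. F_form d a (\<lambda>_. 1\<^sub>m d) Y K s $$ (i, j) =
      (if i < d then if j < d then 1\<^sub>m d $$ (i, j) else 0\<^sub>m d a $$ (i, j - d)
       else if j < d then Y s $$ (i - d, j) else K s $$ (i - d, j - d))"
    unfolding F_form_def using Y K ij
    by (intro ballI index_four_block_fun) (auto simp: mat_fun_on_def)
  have "?L $$ (i, j) = deriv_on I (\<lambda>s. if i < d then if j < d then 1\<^sub>m d $$ (i, j) else 0\<^sub>m d a $$ (i, j - d)
       else if j < d then Y s $$ (i - d, j) else K s $$ (i - d, j - d)) t"
    unfolding index_mat_fun_deriv[OF ij] by (rule deriv_on_cong[OF ent I(2)])
  also have "\<dots> = ?R $$ (i, j)"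
    using ij c by (cases "i < d"; cases "j < d") (simp_all add: deriv_on_const[OF I] index_mat_fun_deriv)
  finally show "?L $$ (i, j) = ?R $$ (i, j)" .
qed (simp_all add: mat_fun_deriv_def)

text \<open>Smoothness is assumed of the assembled pair; this hands it on to \<open>N\<close>,
  \<Omega> and \<open>F21\<close>.\<close>

lemma Ck_mat_fun_blocksD:
  assumes on: "mat_fun_on I n m A" "mat_fun_on I n m' B" "mat_fun_on I n' m C" "mat_fun_on I n' m' D"
    and Ck: "Ck_mat_fun k I (n + n') (m + m') (four_block_fun A B C D)"
  shows "Ck_mat_fun k I n m A" "Ck_mat_fun k I n' m C" "Ck_mat_fun k I n' m' D"
proof -
  have ent: "four_block_fun A B C D t $$ (i, j) =
    (if i < n then if j < m then A t $$ (i, j) else B t $$ (i, j - m)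
     else if j < m then C t $$ (i - n, j) else D t $$ (i - n, j - m))"
    if "t \<in> I" "i < n + n'" "j < m + m'" for t i j
    using on that by (intro index_four_block_fun) (auto simp: mat_fun_on_def)
  show "Ck_mat_fun k I n m A"
  proof (rule Ck_mat_funI)
    show "Ck_on k I (\<lambda>t. A t $$ (i, j))" if "i < n" "j < m" for i j
      by (rule Ck_on_cong[OF Ck_mat_funD(2)[OF Ck, of i j]]) (use that in \<open>simp_all add: ent\<close>)
  qed (use on in \<open>simp add: mat_fun_on_def\<close>)
  show "Ck_mat_fun k I n' m C"
  proof (rule Ck_mat_funI)
    show "Ck_on k I (\<lambda>t. C t $$ (i, j))" if "i < n'" "j < m" for i j
      by (rule Ck_on_cong[OF Ck_mat_funD(2)[OF Ck, of "n + i" j]]) (use that in \<open>simp_all add: ent\<close>)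
  qed (use on in \<open>simp add: mat_fun_on_def\<close>)
  show "Ck_mat_fun k I n' m' D"
  proof (rule Ck_mat_funI)
    show "Ck_on k I (\<lambda>t. D t $$ (i, j))" if "i < n'" "j < m'" for i j
      by (rule Ck_on_cong[OF Ck_mat_funD(2)[OF Ck, of "n + i" "m + j"]]) (use that in \<open>simp_all add: ent\<close>)
  qed (use on in \<open>simp add: mat_fun_on_def\<close>)
qed

text \<open>\<open>F_form d a (\<lambda>_. 1\<^sub>m d) X L\<close> serves as the transformation matrix with blocks \<open>1, 0, X, L\<close>.\<close>

lemma pair_equivI_block_lower:
  assumes I: "perfect I"
    and E: "mat_fun_on I a a N" "mat_fun_on I d d \<Omega>" "mat_fun_on I a d G" "mat_fun_on I a a H"
    and T: "Ck_mat_fun k I a d X" "Ck_mat_fun k I a a L" "Ck_mat_fun k I a d Y" "Ck_mat_fun k I a a K"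
    and det: "\<And>t. t \<in> I \<Longrightarrow> det (L t) \<noteq> 0" "\<And>t. t \<in> I \<Longrightarrow> det (K t) \<noteq> 0"
    and eqs: "\<And>t. t \<in> I \<Longrightarrow> X t + L t * N t * Y t = 0\<^sub>m a d"
      "\<And>t. t \<in> I \<Longrightarrow> L t * N t * K t = N' t"
      "\<And>t. t \<in> I \<Longrightarrow> X t * \<Omega> t + L t * G t + L t * H t * Y t + L t * N t * mat_fun_deriv I a d Y t = G' t"
      "\<And>t. t \<in> I \<Longrightarrow> L t * H t * K t + L t * N t * mat_fun_deriv I a a K t = H' t"
  shows "pair_equiv k I (d + a) (E_form d a N, F_form d a \<Omega> G H) (E_form d a N', F_form d a \<Omega> G' H')"
proof -
  let ?L = "F_form d a (\<lambda>_. 1\<^sub>m d) X L" and ?K = "F_form d a (\<lambda>_. 1\<^sub>m d) Y K"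
  have "Ck_mat_fun k I (d + a) (d + a) ?L" "Ck_mat_fun k I (d + a) (d + a) ?K"
    unfolding F_form_def by (intro Ck_mat_fun_four_block Ck_mat_fun_const I T zero_carrier_mat one_carrier_mat)+
  moreover have "invertible_mat (?L t) \<and> invertible_mat (?K t) \<and>
      E_form d a N' t = ?L t * E_form d a N t * ?K t \<and>
      F_form d a \<Omega> G' H' t = ?L t * F_form d a \<Omega> G H t * ?K t
        + ?L t * E_form d a N t * mat_fun_deriv I (d + a) (d + a) ?K t" if t: "t \<in> I" for t
  proof -
    note c = E[unfolded mat_fun_on_def, rule_format, OF t] T[THEN Ck_mat_funD(1), OF t]
    note c1 = one_carrier_mat[of d] and c0 = zero_carrier_mat[of d d]
    have inv: "invertible_mat (F_form d a (\<lambda>_. 1\<^sub>m d) Z M t)"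
      if "Z t \<in> carrier_mat a d" "M t \<in> carrier_mat a a" "det (M t) \<noteq> 0" for Z M :: mat_fun
    proof (rule invertible_mat_if_det_nonzero)
      show "F_form d a (\<lambda>_. 1\<^sub>m d) Z M t \<in> carrier_mat (d + a) (d + a)"
        using that by (simp add: F_form_def four_block_fun_def)
      show "det (F_form d a (\<lambda>_. 1\<^sub>m d) Z M t) \<noteq> 0"
        using det_four_block_mat_upper_right_zero[OF c1 refl that(1,2)] that(3)
        by (simp add: F_form_def four_block_fun_def)
    qed
    have dK: "mat_fun_deriv I (d + a) (d + a) ?K t =
        four_block_mat (0\<^sub>m d d) (0\<^sub>m d a) (mat_fun_deriv I a d Y t) (mat_fun_deriv I a a K t)"
      using T(3,4) by (intro mat_fun_deriv_block_lower I t) (simp_all add: Ck_mat_fun_def)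
    have LE: "?L t * E_form d a N t = four_block_mat (1\<^sub>m d) (0\<^sub>m d a) (X t) (L t * N t)"
      unfolding F_form_def E_form_def four_block_fun_def
      using c by (subst mult_block_lower) simp_all
    have LF: "?L t * F_form d a \<Omega> G H t =
        four_block_mat (\<Omega> t) (0\<^sub>m d a) (X t * \<Omega> t + L t * G t) (L t * H t)"
      unfolding F_form_def four_block_fun_def using c by (subst mult_block_lower) simp_all
    note cD = mat_fun_deriv_carrier[of I a d Y t] mat_fun_deriv_carrier[of I a a K t]
    have "?L t * E_form d a N t * ?K t = four_block_mat (1\<^sub>m d) (0\<^sub>m d a) (X t + L t * N t * Y t) (L t * N t * K t)"
      unfolding LE unfolding F_form_def four_block_fun_def using c by (subst mult_block_lower) simp_all
    then have "?L t * E_form d a N t * ?K t = E_form d a N' t"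
      using eqs(1,2)[OF t] by (simp add: E_form_def four_block_fun_def)
    moreover have "?L t * F_form d a \<Omega> G H t * ?K t
        + ?L t * E_form d a N t * mat_fun_deriv I (d + a) (d + a) ?K t =
      four_block_mat (\<Omega> t) (0\<^sub>m d a)
        (X t * \<Omega> t + L t * G t + L t * H t * Y t + L t * N t * mat_fun_deriv I a d Y t)
        (L t * H t * K t + L t * N t * mat_fun_deriv I a a K t)"
    proof -
      have 1: "?L t * F_form d a \<Omega> G H t * ?K t = four_block_mat (\<Omega> t) (0\<^sub>m d a)
          (X t * \<Omega> t + L t * G t + L t * H t * Y t) (L t * H t * K t)"
        unfolding LF unfolding F_form_def four_block_fun_def using c by (subst mult_block_lower) simp_all
      have 2: "?L t * E_form d a N t * mat_fun_deriv I (d + a) (d + a) ?K t =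
          four_block_mat (0\<^sub>m d d) (0\<^sub>m d a) (L t * N t * mat_fun_deriv I a d Y t)
            (L t * N t * mat_fun_deriv I a a K t)"
        unfolding LE dK using c cD by (subst mult_block_lower) simp_all
      show ?thesis
        unfolding 1 2 using c cD by (subst add_block_lower) simp_all
    qed
    ultimately show ?thesis
      using inv[of X L] inv[of Y K] c det[OF t] eqs(3,4)[OF t]
      by (simp add: F_form_def[of d a \<Omega> G' H'] four_block_fun_def)
  qed
  ultimately show ?thesis unfolding pair_equiv_def by auto
qed

section \<open>Identifying the inverse and assembling the two equivalences\<close>

lemma mat_fun_inv_eq:
  assumes "R t \<in> carrier_mat n n" "S \<in> carrier_mat n n" "R t * S = 1\<^sub>m n" "S * R t = 1\<^sub>m n"
  shows "mat_fun_inv R t = S"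
proof -
  have "R t \<in> Units (ring_mat TYPE(real) n ())"
    using assms by (auto simp: Units_def ring_mat_def)
  then obtain B where B: "mat_inverse (R t) = Some B"
    using mat_inverse(1)[OF assms(1), of "()"] by (cases "mat_inverse (R t)") auto
  have B': "B * R t = 1\<^sub>m n" "B \<in> carrier_mat n n" using mat_inverse(2)[OF assms(1) B] by auto
  have "B = B * (R t * S)" using assms B' by simp
  also have "\<dots> = (B * R t) * S" by (rule assoc_mult_mat[OF B'(2) assms(1,2), symmetric])
  finally show ?thesis using B B' assms by (simp add: mat_fun_inv_def)
qed

text \<open>The left side is L (G + Y + N D) - L N Y \<Omega>, with \<open>D\<close> standing for
  the derivative of \<open>Y\<close>.\<close>

lemma elimination_identity:
  fixes L N Y :: "real mat"
  assumes c: "L \<in> carrier_mat a a" "N \<in> carrier_mat a a" "Y \<in> carrier_mat a d" "\<Omega> \<in> carrier_mat d d"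
      "G \<in> carrier_mat a d" "D \<in> carrier_mat a d"
    and eq: "G + Y + N * D = N * (Y * \<Omega>)"
  shows "- (L * N * Y) * \<Omega> + L * G + L * Y + L * N * D = 0\<^sub>m a d"
proof -
  have "L * (G + Y + N * D) = L * (G + Y) + L * (N * D)"
    using c by (intro mult_add_distrib_mat) auto
  also have "L * (G + Y) = L * G + L * Y" using c(1,5,3) by (rule mult_add_distrib_mat)
  also have "L * (N * D) = L * N * D" using c(1,2,6) by (rule assoc_mult_mat[symmetric])
  finally have "L * G + L * Y + L * N * D = L * (G + Y + N * D)" ..
  also have "\<dots> = L * N * Y * \<Omega>"
    unfolding eq using c assoc_mult_mat[OF mult_carrier_mat[OF c(1,2)] c(3,4)]
      assoc_mult_mat[OF c(1,2) mult_carrier_mat[OF c(3,4)]] by simp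
  finally have "L * G + L * Y + L * N * D = L * N * Y * \<Omega>" .
  moreover have "- (L * N * Y) * \<Omega> + L * G + L * Y + L * N * D
      = - (L * N * Y * \<Omega>) + (L * G + L * Y + L * N * D)"
    using c by (intro eq_matI) (auto simp: algebra_simps)
  moreover have "L * N * Y * \<Omega> \<in> carrier_mat a d" using c by (intro mult_carrier_mat)
  ultimately show ?thesis by (simp add: uminus_l_inv_mat)
qed

theorem mainTheorem2:
  fixes I :: "real set" and d a :: nat and ls :: "nat list" and k :: enat
  assumes "is_interval I" and "interior I \<noteq> {}"
    and "block_sizes ls" and "a = sum_list ls"
    and "1 \<le> k"
  shows "\<exists>r :: enat. (k \<noteq> \<infinity> \<longrightarrow> r \<noteq> \<infinity>) \<and>
    (\<forall>N \<Omega> F21 :: mat_fun.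
       N \<in> SUT_column I ls \<and> mat_fun_on I d d \<Omega> \<and> mat_fun_on I a d F21 \<and>
       Ck_mat_fun r I (d + a) (d + a) (E_form d a N) \<and>
       Ck_mat_fun r I (d + a) (d + a) (F_form d a \<Omega> F21 (\<lambda>_. 1\<^sub>m a)) \<longrightarrow>
       (\<exists>R F21'.
          R \<in> BUT_nonsingular I ls \<and> mat_fun_on I a d F21' \<and>
          pair_equiv k I (d + a)
            (E_form d a N, F_form d a \<Omega> F21 (\<lambda>_. 1\<^sub>m a))
            (E_form d a (\<lambda>_. N_Ec ls), F_form d a \<Omega> F21' (mat_fun_inv R)) \<and>
          (E_form d a (\<lambda>_. N_Ec ls), F_form d a \<Omega> F21' (mat_fun_inv R)) \<in> PreSCF I d ls \<and>
          pair_equiv k I (d + a)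
            (E_form d a (\<lambda>_. N_Ec ls), F_form d a \<Omega> F21' (mat_fun_inv R))
            (E_form d a (\<lambda>_. N_Ec ls),
             F_form d a \<Omega> (\<lambda>_. 0\<^sub>m a d) (\<lambda>_. 1\<^sub>m a))))"
proof (rule exI, intro conjI allI impI)
  \<comment> \<open>The length accounts for the iterations of the nilpotent equation; the extra 1
    pays for the derivative of \<open>K\<close> that enters \<open>L\<close>.\<close>
  let ?r = "k + 1 + enat (length ls)"
  show "k \<noteq> \<infinity> \<Longrightarrow> ?r \<noteq> \<infinity>" by (cases k) (auto simp: one_enat_def)
  have I: "perfect I" "I \<noteq> {}" using perfect_interval assms(1,2) by auto
  note bs = assms(3) and a = assms(4)
  have r1: "1 \<le> ?r" and kr: "k \<le> ?r" by (simp_all add: add.assoc add.commute add_increasing)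
  fix N \<Omega> F21 :: mat_fun
  assume "N \<in> SUT_column I ls \<and> mat_fun_on I d d \<Omega> \<and> mat_fun_on I a d F21 \<and>
    Ck_mat_fun ?r I (d + a) (d + a) (E_form d a N) \<and>
    Ck_mat_fun ?r I (d + a) (d + a) (F_form d a \<Omega> F21 (\<lambda>_. 1\<^sub>m a))"
  then have Nc: "N \<in> SUT_column I ls" and \<Omega>c: "mat_fun_on I d d \<Omega>" and Fc: "mat_fun_on I a d F21"
    and CE: "Ck_mat_fun ?r I (d + a) (d + a) (E_form d a N)"
    and CF: "Ck_mat_fun ?r I (d + a) (d + a) (F_form d a \<Omega> F21 (\<lambda>_. 1\<^sub>m a))" by blast+
  have NS: "N \<in> SUT I ls" using Nc by (simp add: SUT_column_def)
  then have cN: "mat_fun_on I a a N" and N0: "\<And>t p q. t \<in> I \<Longrightarrow> p < a \<Longrightarrow> q < a \<Longrightarrow>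
      blk ls q \<le> blk ls p \<Longrightarrow> N t $$ (p, q) = 0"
    by (auto simp: SUT_iff a)
  have zo: "mat_fun_on I d a (\<lambda>_. 0\<^sub>m d a)" "mat_fun_on I a d (\<lambda>_. 0\<^sub>m a d)"
    "mat_fun_on I d d (\<lambda>_. 1\<^sub>m d)" "mat_fun_on I a a (\<lambda>_. 1\<^sub>m a)"
    by (simp_all add: mat_fun_on_def)
  have CN: "Ck_mat_fun ?r I a a N"
    using Ck_mat_fun_blocksD(3)[OF zo(3,1,2) cN] CE by (simp add: E_form_def)
  have C\<Omega>: "Ck_mat_fun ?r I d d \<Omega>" and CG: "Ck_mat_fun ?r I a d F21"
    using Ck_mat_fun_blocksD(1,2)[OF \<Omega>c zo(1) Fc zo(4)] CF by (simp_all add: F_form_def)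
  obtain R where CR: "Ck_mat_fun ?r I a a R" and R_inj: "\<And>t. t \<in> I \<Longrightarrow> graded_inj ls (R t)"
    and R_BUT: "\<And>t p q. t \<in> I \<Longrightarrow> p < a \<Longrightarrow> q < a \<Longrightarrow> blk ls q < blk ls p \<Longrightarrow> R t $$ (p, q) = 0"
    and R_suc: "\<And>t p q. t \<in> I \<Longrightarrow> p < a \<Longrightarrow> q < a \<Longrightarrow> has_suc ls q \<Longrightarrow>
      R t $$ (p, q) = N t $$ (p, suc_pos ls q)"
    using column_completion[OF I r1 bs Nc] CN unfolding a by blast
  note cN' = Ck_mat_funD(1)[OF CN] and cR = Ck_mat_funD(1)[OF CR] and cG = Ck_mat_funD(1)[OF CG]
    and c\<Omega> = Ck_mat_funD(1)[OF C\<Omega>] and cJ = N_Ec_carrier[of ls, folded a]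
  have dR: "det (R t) \<noteq> 0" if "t \<in> I" for t
    using graded_inj_det[OF R_inj[OF that]] cR[OF that] by (simp add: a)
  then obtain S where CS: "Ck_mat_fun ?r I a a S"
    and RS: "\<And>t. t \<in> I \<Longrightarrow> R t * S t = 1\<^sub>m a" and SR: "\<And>t. t \<in> I \<Longrightarrow> S t * R t = 1\<^sub>m a"
    using Ck_mat_fun_inverse_exists[OF I(1) CR] by blast
  note cS = Ck_mat_funD(1)[OF CS]
  have inv: "mat_fun_inv R t = S t" if "t \<in> I" for t
    using mat_fun_inv_eq[of R t] cR cS RS SR that by blast
  have RJ: "R t * N_Ec ls = N t" if t: "t \<in> I" for t
    using t N0 R_suc cN'[OF t] cR[OF t] by (intro mult_N_Ec_eq[OF bs]) (simp_all add: a)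
  have SN: "S t * N t = N_Ec ls" if t: "t \<in> I" for t
    using assoc_mult_mat[OF cS[OF t] cR[OF t] cJ] RJ[OF t] SR[OF t] cJ by simp
  have dS: "det (S t) \<noteq> 0" if t: "t \<in> I" for t
    using det_mult[OF cR[OF t] cS[OF t]] RS[OF t] by auto
  have S_BUT: "S t $$ (p, q) = 0" if t: "t \<in> I" and "p < a" "q < a" "blk ls q < blk ls p" for t p q
    using graded_inj_right_inverse_BUT[OF R_inj[OF t]] cR[OF t] cS[OF t] RS[OF t] that by (simp add: a)
  have invM: "invertible_mat (R t)" "invertible_mat (S t)" if "t \<in> I" for t
    using invertible_mat_if_det_nonzero cR cS dR dS that by blast+
  \<comment> \<open>Left multiplication by diag(1, R^-1) acts on the second block row, so it turns
    the identity into R^-1 and \<open>F21\<close> into this product.\<close>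
  let ?F = "\<lambda>t. S t * F21 t"
  have CF': "Ck_mat_fun ?r I a d ?F" by (rule Ck_mat_fun_mult[OF I(1) CS CG])
  note cF' = Ck_mat_funD(1)[OF CF']
  have on: "mat_fun_on I a a R" "mat_fun_on I a d ?F" "mat_fun_on I a a (mat_fun_inv R)"
    using cR cF' cS by (simp_all add: mat_fun_on_def inv)
  have 1: "R \<in> BUT_nonsingular I ls"
    using on R_BUT invM by (simp add: BUT_nonsingular_def BUT_iff a)
  have zero: "Ck_mat_fun k I a d (\<lambda>_. 0\<^sub>m a d)" and one: "Ck_mat_fun k I a a (\<lambda>_. 1\<^sub>m a)"
    by (simp_all add: Ck_mat_fun_const I)
  have CSk: "Ck_mat_fun k I a a S" by (rule Ck_mat_fun_mono[OF I(1) CS kr])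
  have 2: "pair_equiv k I (d + a) (E_form d a N, F_form d a \<Omega> F21 (\<lambda>_. 1\<^sub>m a))
      (E_form d a (\<lambda>_. N_Ec ls), F_form d a \<Omega> ?F (mat_fun_inv R))"
  proof (rule pair_equivI_block_lower[OF I(1) cN \<Omega>c Fc zo(4) zero CSk zero one dS])
    fix t assume t: "t \<in> I"
    note c = cS[OF t] cN'[OF t] c\<Omega>[OF t] cG[OF t] cF'[OF t] cJ
    show "det (1\<^sub>m a) \<noteq> (0 :: real)" by simp
    show "0\<^sub>m a d + S t * N t * 0\<^sub>m a d = 0\<^sub>m a d" using c by simp
    show "S t * N t * 1\<^sub>m a = N_Ec ls" using c SN[OF t] by simp
    show "0\<^sub>m a d * \<Omega> t + S t * F21 t + S t * 1\<^sub>m a * 0\<^sub>m a d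
        + S t * N t * mat_fun_deriv I a d (\<lambda>_. 0\<^sub>m a d) t = S t * F21 t"
      using c by (simp add: mat_fun_deriv_const[OF I(1) t])
    show "S t * 1\<^sub>m a * 1\<^sub>m a + S t * N t * mat_fun_deriv I a a (\<lambda>_. 1\<^sub>m a) t = mat_fun_inv R t"
      using c by (simp add: mat_fun_deriv_const[OF I(1) t] inv[OF t])
  qed
  have S_nonsing: "mat_fun_inv R \<in> BUT_nonsingular I ls"
    using on S_BUT invM by (simp add: BUT_nonsingular_def BUT_iff a inv)
  \<comment> \<open>The upper right block of the second matrix is zero, so the product condition of
    \<open>PreSCF\<close> holds for the zero matrix; the weight lies on \<open>S_nonsing\<close>,
    triangularity of the inverse.\<close>
  have "?F t * 0\<^sub>m d a = 0\<^sub>m a a" if "t \<in> I" for t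
    using cF'[OF that] by (rule right_mult_zero_mat)
  then have F12: "(\<lambda>t. ?F t * 0\<^sub>m d a) \<in> BUT I ls"
    by (simp add: BUT_iff mat_fun_on_def flip: a)
  have 3: "(E_form d a (\<lambda>_. N_Ec ls), F_form d a \<Omega> ?F (mat_fun_inv R)) \<in> PreSCF I d ls"
    unfolding PreSCF_def Let_def a[symmetric] F_form_def mem_Collect_eq case_prod_conv
    by (intro conjI ballI refl, rule exI[of _ \<Omega>], rule exI[of _ "\<lambda>_. 0\<^sub>m d a"],
        rule exI[of _ ?F], rule exI[of _ "mat_fun_inv R"])
      (simp add: S_nonsing F12 \<Omega>c zo(1) on)
  obtain K L where CK: "Ck_mat_fun k I a a K" and CL: "Ck_mat_fun k I a a L"
    and dK: "\<And>t. t \<in> I \<Longrightarrow> det (K t) \<noteq> 0" and dL: "\<And>t. t \<in> I \<Longrightarrow> det (L t) \<noteq> 0"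
    and LNK: "\<And>t. t \<in> I \<Longrightarrow> L t * N t * K t = N_Ec ls"
    and LK: "\<And>t. t \<in> I \<Longrightarrow> L t * (K t + N t * mat_fun_deriv I a a K t) = 1\<^sub>m a"
    using nilpotent_normal_form[OF I(1) bs a NS CN CR R_inj R_BUT R_suc] by blast
  \<comment> \<open>The lemma is used at order k + 1, because \<open>?r\<close> is k + 1 plus the
    number of blocks; \<open>Y\<close> is then cut back to order k.\<close>
  obtain Y where CY: "Ck_mat_fun (k + 1) I a d Y"
    and Y: "\<And>t. t \<in> I \<Longrightarrow> F21 t + Y t + N t * mat_fun_deriv I a d Y t = N t * (Y t * \<Omega> t)"
    using lower_left_elimination[OF I(1) a NS CN CG C\<Omega>] by blast
  have CYk: "Ck_mat_fun k I a d Y" by (rule Ck_mat_fun_mono[OF I(1) CY]) simp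
  note CRk = Ck_mat_fun_mono[OF I(1) CR kr] and CNk = Ck_mat_fun_mono[OF I(1) CN kr]
  \<comment> \<open>The left factor has lower blocks -L N Y and L R. Here \<open>R\<close> restores
    \<open>N\<close> and the identity from \<open>N_Ec ls\<close> and R^-1, after which
    \<open>L\<close> and \<open>K\<close> normalise them; -L N Y cancels what \<open>Y\<close> puts
    into the lower left block of the first matrix.\<close>
  have CX: "Ck_mat_fun k I a d (\<lambda>t. - (L t * N t * Y t))"
    by (intro Ck_mat_fun_uminus I Ck_mat_fun_mult[OF I(1) Ck_mat_fun_mult[OF I(1) CL CNk] CYk])
  have CLR: "Ck_mat_fun k I a a (\<lambda>t. L t * R t)" by (rule Ck_mat_fun_mult[OF I(1) CL CRk])
  have 4: "pair_equiv k I (d + a) (E_form d a (\<lambda>_. N_Ec ls), F_form d a \<Omega> ?F (mat_fun_inv R))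
      (E_form d a (\<lambda>_. N_Ec ls), F_form d a \<Omega> (\<lambda>_. 0\<^sub>m a d) (\<lambda>_. 1\<^sub>m a))"
  proof (rule pair_equivI_block_lower[OF I(1) _ \<Omega>c on(2,3) CX CLR CYk CK _ dK])
    show "mat_fun_on I a a (\<lambda>_. N_Ec ls)" using cJ by (simp add: mat_fun_on_def)
    fix t assume t: "t \<in> I"
    note c = cR[OF t] cS[OF t] cN'[OF t] c\<Omega>[OF t] cG[OF t] cF'[OF t] cJ
      Ck_mat_funD(1)[OF CL t] Ck_mat_funD(1)[OF CK t] Ck_mat_funD(1)[OF CY t]
      mat_fun_deriv_carrier[of I a d Y t] mat_fun_deriv_carrier[of I a a K t]
    have LRJ: "L t * R t * N_Ec ls = L t * N t"
      using assoc_mult_mat[OF c(8,1,7)] RJ[OF t] by simp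
    have LRS: "L t * R t * S t = L t"
      using assoc_mult_mat[OF c(8,1,2)] RS[OF t] c(8) by simp
    have "L t * R t * ?F t = L t * R t * S t * F21 t"
      using c by (intro assoc_mult_mat[symmetric]) auto
    then have LRF: "L t * R t * ?F t = L t * F21 t" by (simp add: LRS)
    show "det (L t * R t) \<noteq> 0" using det_mult[OF c(8,1)] dL dR t by simp
    show "- (L t * N t * Y t) + L t * R t * N_Ec ls * Y t = 0\<^sub>m a d"
      unfolding LRJ using c by (intro uminus_l_inv_mat) auto
    show "L t * R t * N_Ec ls * K t = N_Ec ls" unfolding LRJ by (rule LNK[OF t])
    show "- (L t * N t * Y t) * \<Omega> t + L t * R t * ?F t + L t * R t * mat_fun_inv R t * Y t
        + L t * R t * N_Ec ls * mat_fun_deriv I a d Y t = 0\<^sub>m a d"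
      unfolding LRJ LRF inv[OF t] LRS
      by (rule elimination_identity[OF c(8,3,10,4,5,11) Y[OF t]])
    have "L t * (K t + N t * mat_fun_deriv I a a K t) = L t * K t + L t * (N t * mat_fun_deriv I a a K t)"
      using c by (intro mult_add_distrib_mat) auto
    then show "L t * R t * mat_fun_inv R t * K t + L t * R t * N_Ec ls * mat_fun_deriv I a a K t = 1\<^sub>m a"
      unfolding LRJ inv[OF t] LRS using LK[OF t] assoc_mult_mat[OF c(8,3,12)] by simp
  qed
  show "\<exists>R F21'. R \<in> BUT_nonsingular I ls \<and> mat_fun_on I a d F21' \<and>
      pair_equiv k I (d + a) (E_form d a N, F_form d a \<Omega> F21 (\<lambda>_. 1\<^sub>m a))
        (E_form d a (\<lambda>_. N_Ec ls), F_form d a \<Omega> F21' (mat_fun_inv R)) \<and>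
      (E_form d a (\<lambda>_. N_Ec ls), F_form d a \<Omega> F21' (mat_fun_inv R)) \<in> PreSCF I d ls \<and>
      pair_equiv k I (d + a) (E_form d a (\<lambda>_. N_Ec ls), F_form d a \<Omega> F21' (mat_fun_inv R))
        (E_form d a (\<lambda>_. N_Ec ls), F_form d a \<Omega> (\<lambda>_. 0\<^sub>m a d) (\<lambda>_. 1\<^sub>m a))"
    using 1 on(2) 2 3 4 by blast
qed

end
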